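(* Suppose that $\mathscr{B},\mathscr{B}'\subset\mathbb{N}$ are taut. Then the following conditions are equivalent: (a) $\mathscr{B}=\mathscr{B}'$; (b) $\mathcal{M}_{\mathscr{B}}=\mathcal{M}_{\mathscr{B}'}$; (c) $X_{\mathscr{B}}=X_{\mathscr{B}'}$; (d) $\widetilde{X}_\eta=\widetilde{X}_{\eta'}$; (e) $X_\eta=X_{\eta'}$; (f) $\nu_\eta=\nu_{\eta'}$; (g) $\mathcal{P}(S,\widetilde{X}_\eta)=\mathcal{P}(S,\widetilde{X}_{\eta'})$.
   Context: $\mathbb{N}=\{1,2,\dots\}$. For $\mathscr{B}\subset\mathbb{N}$ let $\mathcal{M}_{\mathscr{B}}:=\bigcup_{b\in\mathscr{B}}b\mathbb{Z}$, $\mathcal{F}_{\mathscr{B}}:=\mathbb{Z}\setminus\mathcal{M}_{\mathscr{B}}$; $\eta,\eta'\in\{0,1\}^{\mathbb{Z}}$ are the characteristic functions of $\mathcal{F}_{\mathscr{B}},\mathcal{F}_{\mathscr{B}'}$ respectively. $S$ is the left shift on $\{0,1\}^{\mathbb{Z}}$ (product topology), and $X_\eta$ is the closure of $\{S^m\eta : m\in\mathbb{Z}\}$. A subshift $X\subset\{0,1\}^{\mathbb{Z}}$ (closed, $S$-invariant set) is hereditary if $x\in X$ and $y\le x$ coordinatewise imply $y\in X$; $\widetilde{X}_\eta$ is the smallest hereditary subshift containing $X_\eta$. With $\operatorname{supp}x:=\{n\in\mathbb{Z}: x(n)=1\}$, $X_{\mathscr{B}}:=\{x\in\{0,1\}^{\mathbb{Z}}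 : |\operatorname{supp}x\bmod b|<b\text{ for each }b\in\mathscr{B}\}$, where $\operatorname{supp}x\bmod b$ is the image in $\mathbb{Z}/b\mathbb{Z}$. $\mathcal{P}(S,X)$ is the set of $S$-invariant Borel probability measures on $X$, regarded as measures on $\{0,1\}^{\mathbb{Z}}$ supported on $X$. Mirsky measure: let $G$ be the closure of $\{(n \bmod b)_{b\in\mathscr{B}} : n\in\mathbb{Z}\}$ in the compact group $\prod_{b\in\mathscr{B}}\mathbb{Z}/b\mathbb{Z}$, let $\mathbb{P}$ be the normalized Haar measure of $G$, and define $\varphi\colon G\to\{0,1\}^{\mathbb{Z}}$ by $\varphi(g)(n)=1$ iff $n\not\equiv -g_b \bmod b$ for all $b\in\mathscr{B}$ (and $0$ otherwise); then $\nu_\eta:=\varphi_*(\mathbb{P})$. The objects $X_{\eta'},\widetilde{X}_{\eta'},\nu_{\eta'}$ are defined in the same way from $\mathscr{B}'$. The logarithmic density of $A\subset\mathbb{Z}$ is $\boldsymbol{\delta}(A)=\lim_{N\to\infty}\frac{1}{\log N}\sum_{a\in A,1\le a\le N}\frac1a$ when the limit exists; it always exists for $A=\mathcal{M}_{\mathscr{B}}$ (Davenport–Erdős). $\mathscr{B}$ is taut if $\boldsymbol{\delta}(\mathcal{M}_{\mathscr{B}\setminus\{b\}})<\boldsymbol{\delta}(\mathcal{M}_{\mathscr{B}})$ for each $b\in\mathscr{B}$. *)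

theory Defs
  imports
    "HOL-Probability.Probability"
    "HOL-Algebra.Elementary_Groups"
    "HOL-Algebra.Product_Groups"
    "HOL-Number_Theory.Cong"
begin

section \<open>Sets of multiples, logarithmic density, taut sets\<close>

definition multiples :: "nat set \<Rightarrow> int set" where
  "multiples B = (\<Union>b\<in>B. {n. int b dvd n})"

definition free_integers :: "nat set \<Rightarrow> int set" where
  "free_integers B = UNIV - multiples B"

text \<open>Only meaningful when the limit exists, which is always so for sets of multiples
  (Davenport--Erdos).\<close>

definition log_density :: "int set \<Rightarrow> real" where
  "log_density A = lim (\<lambda>N::nat. (\<Sum>a\<in>A \<inter> {1..int N}. 1 / real_of_int a) / ln (real N))"

definition taut :: "nat set \<Rightarrow> bool" where
  "taut B \<longleftrightarrow> (\<forall>b\<in>B. log_density (multiples (B - {b})) < log_density (multiples B))"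

section \<open>Subshifts of the two-sided full shift\<close>

text \<open>The space of two-sided 0-1 sequences is \<^typ>\<open>int \<Rightarrow> bool\<close>, with \<^const>\<open>False\<close> for 0
  and \<^const>\<open>True\<close> for 1. Its library topology is the product of the discrete topologies, its
  library order is the coordinatewise one, and \<^const>\<open>borel\<close> is taken for that topology.\<close>

type_synonym biseq = "int \<Rightarrow> bool"

definition shift_by :: "int \<Rightarrow> biseq \<Rightarrow> biseq" where
  "shift_by m x = (\<lambda>n. x (n + m))"

abbreviation shift :: "biseq \<Rightarrow> biseq" where
  "shift \<equiv> shift_by 1"

lemma shift_by_0: "shift_by 0 x = x"
  by (simp add: shift_by_def)

lemma shift_by_add: "shift_by m (shift_by k x) = shift_by (m + k) x"
  by (simp add: shift_by_def add.assoc)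

lemma inj_shift_by: "inj (shift_by m)"
  by (rule inj_on_inverseI[where g = "shift_by (- m)"]) (simp add: shift_by_add shift_by_0)

lemma surj_shift_by: "surj (shift_by m)"
  by (rule surjI[where f = "shift_by (- m)"]) (simp add: shift_by_add shift_by_0)

definition subshift :: "biseq set \<Rightarrow> bool" where
  "subshift X \<longleftrightarrow> closed X \<and> shift ` X = X"

definition hereditary :: "biseq set \<Rightarrow> bool" where
  "hereditary X \<longleftrightarrow> (\<forall>x\<in>X. \<forall>y. y \<le> x \<longrightarrow> y \<in> X)"

definition supp :: "biseq \<Rightarrow> int set" where
  "supp x = {n. x n}"

definition eta :: "nat set \<Rightarrow> biseq" where
  "eta B = (\<lambda>n. n \<in> free_integers B)"

definition X_eta :: "nat set \<Rightarrow> biseq set" where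
  "X_eta B = closure (range (\<lambda>m. shift_by m (eta B)))"

definition hereditary_hull :: "biseq set \<Rightarrow> biseq set" where
  "hereditary_hull X = \<Inter>{Y. subshift Y \<and> hereditary Y \<and> X \<subseteq> Y}"

lemma hereditary_hull_smallest:
  "subshift (hereditary_hull X)" "hereditary (hereditary_hull X)" "X \<subseteq> hereditary_hull X"
  "\<lbrakk>subshift Y; hereditary Y; X \<subseteq> Y\<rbrakk> \<Longrightarrow> hereditary_hull X \<subseteq> Y"
proof -
  let ?F = "{Y. subshift Y \<and> hereditary Y \<and> X \<subseteq> Y}"
  have "UNIV \<in> ?F"
    by (auto simp: subshift_def hereditary_def surj_shift_by)
  hence "shift ` \<Inter>?F = (\<Inter>Y\<in>?F. shift ` Y)"
    using image_INT[OF inj_shift_by, where A = ?F and B = "\<lambda>Y. Y" and j = UNIV] by simp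
  also have "\<dots> = \<Inter>?F"
    by (auto simp: subshift_def)
  finally show "subshift (hereditary_hull X)"
    by (auto simp: hereditary_hull_def subshift_def)
  show "hereditary (hereditary_hull X)"
    by (auto simp: hereditary_hull_def hereditary_def)
  show "X \<subseteq> hereditary_hull X"
    by (auto simp: hereditary_hull_def)
  show "\<lbrakk>subshift Y; hereditary Y; X \<subseteq> Y\<rbrakk> \<Longrightarrow> hereditary_hull X \<subseteq> Y"
    by (auto simp: hereditary_hull_def)
qed

abbreviation X_eta_hereditary :: "nat set \<Rightarrow> biseq set" where
  "X_eta_hereditary B \<equiv> hereditary_hull (X_eta B)"

definition admissible :: "nat set \<Rightarrow> biseq set" where
  "admissible B = {x. \<forall>b\<in>B. card ((\<lambda>n. n mod int b) ` supp x) < b}"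

section \<open>Invariant measures\<close>

definition invariant_measures :: "biseq set \<Rightarrow> biseq measure set" where
  "invariant_measures X =
     {\<mu>. sets \<mu> = sets borel \<and> prob_space \<mu> \<and> distr \<mu> borel shift = \<mu> \<and> emeasure \<mu> X = 1}"

section \<open>The Mirsky measure\<close>

text \<open>The normalized Haar measure on a compact subgroup of \<^term>\<open>R\<close> whose underlying set is the
  whole space of the topology \<^term>\<open>T\<close>. For compact metrizable groups, the only ones to which
  this is applied, every Borel probability measure is regular, so that the measure described here
  exists and is unique.\<close>

definition haar_probability :: "('a, 'b) monoid_scheme \<Rightarrow> 'a topology \<Rightarrow> 'a measure" where
  "haar_probability R T =
     (THE P. prob_space P \<and> space P = topspace T \<and>
             sets P = sigma_sets (topspace T) {U. openin T U} \<and>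
             (\<forall>g\<in>topspace T. distr P P (\<lambda>h. g \<otimes>\<^bsub>R\<^esub> h) = P))"

text \<open>For positive \<^term>\<open>b\<close> the group \<^term>\<open>integer_mod_group b\<close> is the cyclic group of order
  \<^term>\<open>b\<close>, on the residues from 0 to \<^term>\<open>b - 1\<close>.\<close>

definition residue_product :: "nat set \<Rightarrow> (nat \<Rightarrow> int) monoid" where
  "residue_product B = product_group B integer_mod_group"

definition residue_topology :: "nat set \<Rightarrow> (nat \<Rightarrow> int) topology" where
  "residue_topology B =
     product_topology (\<lambda>b. discrete_topology (carrier (integer_mod_group b))) B"

definition residue_closure :: "nat set \<Rightarrow> (nat \<Rightarrow> int) set" where
  "residue_closure B =
     residue_topology B closure_of range (\<lambda>n::int. \<lambda>b\<in>B. n mod int b)"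

definition mirsky_map :: "nat set \<Rightarrow> (nat \<Rightarrow> int) \<Rightarrow> biseq" where
  "mirsky_map B g = (\<lambda>n. \<forall>b\<in>B. [n \<noteq> - g b] (mod int b))"

definition mirsky_measure :: "nat set \<Rightarrow> biseq measure" where
  "mirsky_measure B =
     distr (haar_probability (residue_product B)
              (subtopology (residue_topology B) (residue_closure B)))
           borel (mirsky_map B)"

end

theory Submission
  imports Defs
begin

text \<open>Since a taut set contains no two distinct elements one of which divides the other, \<open>B = B'\<close> follows
once every element of \<open>B'\<close> is a multiple of an element of \<open>B\<close> and conversely
(\<open>taut_eq_if_mutually_dividing\<close>). For equal sets of multiples this is immediate. In the other five cases a
sequence associated with \<open>B\<close> turns out to be admissible for \<open>B'\<close>, that is, it vanishes on a residue class modulo every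
\<open>b' \<in> B'\<close>: equality of any of the three subshifts makes \<open>eta B\<close> admissible for \<open>B'\<close>, and equality of the Mirsky
measures or of the sets of invariant measures makes almost every sequence drawn from the Mirsky measure
of \<open>B\<close> admissible for \<open>B'\<close>. It remains to see that a residue class modulo \<open>b'\<close> without \<open>B\<close>-free elements
forces an element of \<open>B\<close> to divide \<open>b'\<close>.

Everything is measured in one probability space, that of a uniformly random profinite integer
\<open>\<omega>\<close>. The event that no \<open>b \<in> B\<close> divides \<open>\<omega>\<close> has the probability \<open>density_free B\<close>, the limit of the
densities of the \<open>K\<close>-free integers for the finite truncations \<open>K\<close> of \<open>B\<close>. The key statement
about taut sets is \<open>taut_covered_class\<close>: if almost every \<open>\<omega> \<equiv> r (mod a)\<close> is divisible by an element
of \<open>B\<close>, then an element of \<open>B\<close> divides \<open>a\<close>. Cancelling \<open>gcd a r\<close> turns the hypothesis into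
the statement that almost every \<open>\<omega>\<close> is a multiple of an element of one of finitely many sets \<open>C\<^sub>e\<close> with
\<open>e C\<^sub>e \<subseteq> B\<close>; by the correlation inequality \<open>density_free_correlation\<close> a single \<open>C\<^sub>e\<close> already has this property. If
\<open>1 \<notin> C\<^sub>e\<close>, one element can be removed from \<open>C\<^sub>e\<close> without destroying it, and the corresponding element of
\<open>B\<close> is then superfluous for the logarithmic density, contradicting tautness.

Two bridges lead from sequences to \<open>\<omega>\<close>. The first, \<open>sieve_transfer\<close>, is the Davenport--Erdos theorem in
disguise: a pattern of \<open>B\<close>-free positions that occurs for \<open>\<omega>\<close> with positive probability also occurs in the
integers. It rests on the weights \<open>n\<^sup>-\<^sup>s\<close> with \<open>s \<rightarrow> 1\<close> from the right. Periodic sets have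
asymptotically their density as frequency under these weights, while the frequency of the \<open>B\<close>-free integers is at
least \<open>density_free B\<close> for \<^emph>\<open>every\<close> \<open>s > 1\<close>, because by Harris' inequality on divisor lattices it
decreases when \<open>s\<close> does. The second bridge, \<open>sieve_ergodic\<close>, is the ergodicity of integer translations, proved by
averaging over a full period of a finite truncation.

Finally the Mirsky measure is the law of the random sequence \<open>sieve B \<omega>\<close>
(\<open>mirsky_measure_eq\<close>), where \<open>\<omega>\<close> is built from independent digits in the factorial number system. This needs
existence and uniqueness of the Haar measure on the closure of the integers in the product of the cyclic groups;
both follow from the fact that all cylinders over the same finite set of moduli are translates
of each other.\<close>

section \<open>Weights \<open>n\<^sup>-\<^sup>s\<close>\<close>

text \<open>The term for \<open>n = 0\<close> vanishes, since \<open>0 powr x = 0\<close>; only the positive elements of \<open>S\<close> are counted.\<close>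

definition zmass :: "real \<Rightarrow> int set \<Rightarrow> real" where
  "zmass s S = (\<Sum>n. of_bool (int n \<in> S) * real n powr - s)"

lemma summable_zmass:
  assumes "s > 1"
  shows "summable (\<lambda>n. of_bool (int n \<in> S) * real n powr - s)"
proof (rule summable_comparison_test'[where N = 0])
  show "summable (\<lambda>n. real n powr - s)"
    using assms by (simp add: summable_real_powr_iff)
qed auto

lemma zmass_nonneg: "s > 1 \<Longrightarrow> 0 \<le> zmass s S"
  unfolding zmass_def by (intro suminf_nonneg summable_zmass) auto

lemma zmass_mono:
  assumes "s > 1" and "\<And>n. n \<ge> 1 \<Longrightarrow> n \<in> S \<Longrightarrow> n \<in> T"
  shows "zmass s S \<le> zmass s T"
  unfolding zmass_def
proof (intro suminf_le summable_zmass assms(1))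
  fix n
  show "of_bool (int n \<in> S) * real n powr - s \<le> of_bool (int n \<in> T) * real n powr - s"
    using assms(2)[of "int n"] by (cases "n = 0") auto
qed

lemma zmass_Un_le:
  assumes "s > 1"
  shows "zmass s (S \<union> T) \<le> zmass s S + zmass s T"
  unfolding zmass_def suminf_add[OF summable_zmass summable_zmass, OF assms assms]
  by (intro suminf_le summable_add summable_zmass assms) auto

lemma zmass_diff:
  assumes "s > 1" and "T \<subseteq> S"
  shows "zmass s (S - T) = zmass s S - zmass s T"
  unfolding zmass_def suminf_diff[OF summable_zmass summable_zmass, OF assms(1) assms(1)]
  using assms(2) by (intro suminf_cong) auto

lemma zmass_UN_le:
  assumes "s > 1" and "finite I"
  shows "zmass s (\<Union>i\<in>I. S i) \<le> (\<Sum>i\<in>I. zmass s (S i))"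
  using assms(2)
proof (induction I rule: finite_induct)
  case empty
  show ?case by (simp add: zmass_def)
next
  case (insert i I)
  then show ?case using zmass_Un_le[OF assms(1), of "S i" "\<Union>i\<in>I. S i"] by auto
qed

lemma powr_telescope_sums:
  fixes t :: real
  assumes "t > 0"
  shows "(\<lambda>n. real (Suc n) powr - t - real (Suc (Suc n)) powr - t) sums 1"
proof -
  have "(\<lambda>n. real n powr - t) \<longlonglongrightarrow> 0"
    using assms by (intro tendsto_neg_powr filterlim_real_sequentially) auto
  then have "(\<lambda>n. real (Suc n) powr - t) \<longlonglongrightarrow> 0"
    by (rule LIMSEQ_Suc)
  from telescope_sums'[OF this] show ?thesis by simp
qed

text \<open>The mean value theorem compares \<open>(s - 1) n\<^sup>-\<^sup>s\<close> with the difference quotient of \<open>x\<^sup>1\<^sup>-\<^sup>s\<close> on either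
side of \<open>n\<close>, and these differences telescope to \<open>1\<close>.\<close>

lemma zeta_bounds:
  assumes "s > 1"
  shows "1 / (s - 1) \<le> zmass s UNIV" and "zmass s UNIV \<le> s / (s - 1)"
proof -
  define g where "g n = real (Suc n) powr - (s - 1)" for n
  have step: "g n - g (Suc n) \<le> (s - 1) * real (Suc n) powr - s \<and>
              (s - 1) * real (Suc (Suc n)) powr - s \<le> g n - g (Suc n)" for n
  proof -
    have "\<exists>z>real (Suc n). z < real (Suc (Suc n)) \<and>
        real (Suc (Suc n)) powr (1 - s) - real (Suc n) powr (1 - s) =
        (real (Suc (Suc n)) - real (Suc n)) * ((1 - s) * z powr (1 - s - 1))"
      by (intro MVT2) (auto intro!: derivative_eq_intros)
    then obtain z where z: "z > real (Suc n)" "z < real (Suc (Suc n))"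
      "g n - g (Suc n) = (s - 1) * z powr - s"
      by (auto simp: g_def algebra_simps)
    have "z powr - s \<le> real (Suc n) powr - s" "real (Suc (Suc n)) powr - s \<le> z powr - s"
      using z assms by (auto intro!: powr_mono2')
    then show ?thesis using z(3) assms by auto
  qed
  have g: "(\<lambda>n. g n - g (Suc n)) sums 1"
    using powr_telescope_sums[of "s - 1"] assms by (simp add: g_def)
  have sm: "summable (\<lambda>n. real n powr - s)"
    using assms by (simp add: summable_real_powr_iff)
  have z: "zmass s UNIV = (\<Sum>n. real n powr - s)"
    by (simp add: zmass_def)
  have sm1: "summable (\<lambda>n. real (Suc n) powr - s)"
    using sm by (subst summable_Suc_iff)
  have sm2: "summable (\<lambda>n. real (Suc (Suc n)) powr - s)"
    using sm1 by (subst summable_Suc_iff)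
  have z1: "zmass s UNIV = (\<Sum>n. real (Suc n) powr - s)"
    unfolding z using suminf_split_head[OF sm] by simp
  have z2: "zmass s UNIV = 1 + (\<Sum>n. real (Suc (Suc n)) powr - s)"
    unfolding z1 using suminf_split_head[OF sm1] by simp
  have "1 \<le> (\<Sum>n. (s - 1) * real (Suc n) powr - s)"
    using suminf_le[OF _ sums_summable[OF g] summable_mult[OF sm1]] step sums_unique[OF g] by auto
  then have "1 \<le> (s - 1) * zmass s UNIV"
    unfolding z1 by (subst (asm) suminf_mult[OF sm1])
  then show "1 / (s - 1) \<le> zmass s UNIV"
    using assms by (simp add: field_simps)
  have "(\<Sum>n. (s - 1) * real (Suc (Suc n)) powr - s) \<le> 1"
    using suminf_le[OF _ summable_mult[OF sm2] sums_summable[OF g]] step sums_unique[OF g] by auto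
  then have "(s - 1) * (zmass s UNIV - 1) \<le> 1"
    unfolding z2 by (subst (asm) suminf_mult[OF sm2]) simp
  then show "zmass s UNIV \<le> s / (s - 1)"
    using assms by (simp add: field_simps)
qed

lemma zmass_UNIV_pos: "s > 1 \<Longrightarrow> 0 < zmass s UNIV"
  using zeta_bounds(1)[of s] by (smt (verit) divide_pos_pos)

abbreviation freq :: "real \<Rightarrow> int set \<Rightarrow> real" where
  "freq s S \<equiv> zmass s S / zmass s UNIV"

text \<open>Translating a set by one step changes its mass only by the total variation of the weights
\<open>0, 1, 2\<^sup>-\<^sup>s, 3\<^sup>-\<^sup>s, \<dots>\<close>, which is \<open>2\<close> independently of \<open>s\<close>. As the total mass tends to infinity for
\<open>s \<rightarrow> 1\<close>, frequencies become translation invariant in the limit.\<close>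

lemma zmass_shift_Suc:
  assumes "s > 1"
  shows "\<bar>zmass s {n. n + 1 \<in> S} - zmass s S\<bar> \<le> 2"
proof -
  define w where "w n = real n powr - s" for n
  define a :: "nat \<Rightarrow> real" where "a n = of_bool (int n + 1 \<in> S)" for n
  have sm: "summable (\<lambda>n. of_bool (int n \<in> S) * w n)"
    using summable_zmass[OF assms] by (simp add: w_def)
  have sm': "summable (\<lambda>n. a n * w n)"
    using summable_zmass[OF assms, of "{n. n + 1 \<in> S}"] by (simp add: w_def a_def)
  have sms: "summable (\<lambda>n. a n * w (Suc n))"
    using sm unfolding summable_Suc_iff[symmetric, of "\<lambda>n. of_bool (int n \<in> S) * w n"]
    by (simp add: a_def add.commute)
  have "zmass s S = (\<Sum>n. a n * w (Suc n))"
    using suminf_split_head[OF sm] by (simp add: zmass_def a_def w_def add.commute)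
  moreover have "zmass s {n. n + 1 \<in> S} = (\<Sum>n. a n * w n)"
    by (simp add: zmass_def w_def a_def)
  ultimately have eq: "zmass s {n. n + 1 \<in> S} - zmass s S = (\<Sum>n. a n * (w n - w (Suc n)))"
    using suminf_diff[OF sm' sms] by (simp add: algebra_simps)
  have dec: "w (Suc n) \<ge> w (Suc (Suc n))" for n
    unfolding w_def using assms by (intro powr_mono2') auto
  have tel: "(\<lambda>n. w (Suc n) - w (Suc (Suc n))) sums 1"
    unfolding w_def using assms by (intro powr_telescope_sums) auto
  have "(\<lambda>n. \<bar>w (Suc n) - w (Suc (Suc n))\<bar>) sums 1"
    using tel dec by simp
  then have abs: "(\<lambda>n. \<bar>w n - w (Suc n)\<bar>) sums 2"
    by (subst (asm) sums_Suc_iff) (simp add: w_def)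
  have "norm (\<Sum>n. a n * (w n - w (Suc n))) \<le> (\<Sum>n. \<bar>w n - w (Suc n)\<bar>)"
  proof (rule norm_suminf_le)
    show "summable (\<lambda>n. \<bar>w n - w (Suc n)\<bar>)" using abs by (rule sums_summable)
  qed (auto simp: a_def)
  then show ?thesis using eq sums_unique[OF abs] by simp
qed

lemma zmass_shift:
  assumes "s > 1"
  shows "\<bar>zmass s {n. n + int k \<in> S} - zmass s S\<bar> \<le> 2 * real k"
proof (induction k)
  case 0
  then show ?case by simp
next
  case (Suc k)
  have "{n. n + 1 \<in> {n. n + int k \<in> S}} = {n. n + int (Suc k) \<in> S}"
    by (auto simp: algebra_simps)
  then show ?case
    using zmass_shift_Suc[OF assms, of "{n. n + int k \<in> S}"] Suc by auto
qed

lemma zmass_sum_cong: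
  assumes s: "s > 1" and "finite I"
    and "\<And>n. (\<Sum>i\<in>I. of_bool (n \<in> S i)) = (c :: real)"
  shows "(\<Sum>i\<in>I. zmass s (S i)) = c * zmass s UNIV"
proof -
  have sm: "summable (\<lambda>n. real n powr - s)"
    using s by (simp add: summable_real_powr_iff)
  have "(\<Sum>i\<in>I. zmass s (S i)) = (\<Sum>n. \<Sum>i\<in>I. of_bool (int n \<in> S i) * real n powr - s)"
    unfolding zmass_def by (rule suminf_sum[symmetric]) (rule summable_zmass[OF s])
  also have "\<dots> = (\<Sum>n. c * real n powr - s)"
    using assms(3) by (simp flip: sum_distrib_right)
  also have "\<dots> = c * zmass s UNIV"
    using suminf_mult[OF sm] by (simp add: zmass_def)
  finally show ?thesis .
qed

definition periodic :: "nat \<Rightarrow> int set \<Rightarrow> bool" where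
  "periodic q S \<longleftrightarrow> (\<forall>n. n + int q \<in> S \<longleftrightarrow> n \<in> S)"

lemma periodic_mod:
  assumes "periodic q S"
  shows "n mod int q \<in> S \<longleftrightarrow> n \<in> S"
proof -
  have 1: "m + int q * int k \<in> S \<longleftrightarrow> m \<in> S" for m k
  proof (induction k)
    case (Suc k)
    then show ?case using assms[unfolded periodic_def, rule_format, of "m + int q * int k"]
      by (simp add: algebra_simps)
  qed simp
  show ?thesis
  proof (cases "n div int q \<ge> 0")
    case True
    then show ?thesis using 1[of "n mod int q" "nat (n div int q)"] by simp
  next
    case False
    then have "n + int q * int (nat (- (n div int q))) = n mod int q"
      by (simp add: minus_mult_div_eq_mod[symmetric] algebra_simps)
    then show ?thesis using 1[of n "nat (- (n div int q))"] by simp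
  qed
qed

lemma sum_periodic:
  assumes "periodic q S" "q > 0"
  shows "(\<Sum>k<q. of_bool (n + int k \<in> S)) = (real (card (S \<inter> {0..<int q})))"
proof -
  have "bij_betw (\<lambda>k. (n + int k) mod int q) {..<q} {0..<int q}"
  proof (rule bij_betw_byWitness[where f' = "\<lambda>j. nat ((j - n) mod int q)"])
    show "\<forall>a\<in>{..<q}. nat (((n + int a) mod int q - n) mod int q) = a"
      by (simp add: mod_diff_left_eq)
    show "\<forall>a'\<in>{0..<int q}. (n + int (nat ((a' - n) mod int q))) mod int q = a'"
      using assms(2) by (auto simp: mod_add_right_eq)
  qed (use assms(2) in \<open>auto simp: nat_less_iff\<close>)
  then have "(\<Sum>k<q. of_bool (((n + int k) mod int q) \<in> S)) = (\<Sum>j\<in>{0..<int q}. of_bool (j \<in> S) :: real)"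
    by (rule sum.reindex_bij_betw)
  also have "\<dots> = real (card (S \<inter> {0..<int q}))"
    by (simp add: sum_of_bool_eq Int_commute Int_def)
  finally show ?thesis using periodic_mod[OF assms(1)] by simp
qed

text \<open>The \<open>q\<close> translates of a \<open>q\<close>-periodic set cover every integer equally often, and by \<open>zmass_shift\<close> they all
have nearly the same mass.\<close>

lemma freq_periodic_bound:
  assumes "s > 1" "periodic q S" "q > 0"
  shows "\<bar>freq s S - card (S \<inter> {0..<int q}) / q\<bar> \<le> 2 * q * (s - 1)"
proof -
  let ?c = "real (card (S \<inter> {0..<int q}))" and ?Z = "zmass s UNIV"
  have Z: "?Z > 0" by (rule zmass_UNIV_pos[OF assms(1)])
  have "(\<Sum>k<q. zmass s {n. n + int k \<in> S}) = ?c * ?Z"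
    using sum_periodic[OF assms(2,3)] by (intro zmass_sum_cong assms) auto
  then have "?c * ?Z - q * zmass s S = (\<Sum>k<q. zmass s {n. n + int k \<in> S} - zmass s S)"
    by (simp add: sum_subtractf)
  also have "\<bar>\<dots>\<bar> \<le> (\<Sum>k<q. \<bar>zmass s {n. n + int k \<in> S} - zmass s S\<bar>)"
    by (rule sum_abs)
  also have "\<dots> \<le> (\<Sum>k<q. 2 * real q)"
  proof (rule sum_mono)
    fix k assume "k \<in> {..<q}"
    then show "\<bar>zmass s {n. n + int k \<in> S} - zmass s S\<bar> \<le> 2 * real q"
      using zmass_shift[OF assms(1), of k S] by auto
  qed
  also have "\<dots> = 2 * q * q" by simp
  finally have "\<bar>?c * ?Z - q * zmass s S\<bar> \<le> 2 * q * q" .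
  moreover have "zmass s S / ?Z - ?c / q = - (?c * ?Z - q * zmass s S) / (q * ?Z)"
    using Z assms(3) by (simp add: field_simps)
  then have "\<bar>zmass s S / ?Z - ?c / q\<bar> = \<bar>?c * ?Z - q * zmass s S\<bar> / (q * ?Z)"
    using Z by (simp only: abs_divide abs_minus_cancel) simp
  ultimately have "\<bar>zmass s S / ?Z - ?c / q\<bar> \<le> 2 * q * q / (q * ?Z)"
    using Z by (simp only:) (intro divide_right_mono, auto)
  also have "\<dots> = 2 * real q * (1 / ?Z)" using assms(3) by simp
  also have "\<dots> \<le> 2 * real q * (s - 1)"
    using zeta_bounds(1)[OF assms(1)] Z assms(1) by (intro mult_left_mono) (auto simp: field_simps)
  finally show ?thesis .
qed

lemma freq_periodic_tendsto:
  assumes "periodic q S" "q > 0"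
  shows "((\<lambda>s. freq s S) \<longlongrightarrow> card (S \<inter> {0..<int q}) / q) (at_right 1)"
proof (rule LIM_zero_cancel, rule Lim_null_comparison)
  show "\<forall>\<^sub>F s in at_right 1. norm (freq s S - card (S \<inter> {0..<int q}) / q) \<le> 2 * real q * (s - 1)"
    using freq_periodic_bound[OF _ assms] by (auto simp: eventually_at_filter intro!: always_eventually)
  show "((\<lambda>s. 2 * real q * (s - 1)) \<longlongrightarrow> 0) (at_right 1)"
    by (auto intro!: tendsto_eq_intros)
qed

section \<open>Correlation of sets closed under divisors\<close>

text \<open>Chebyshev's sum inequality with weights, which is Harris' inequality on a chain: the double sum of
\<open>v\<^sub>i v\<^sub>j (F\<^sub>i - F\<^sub>j) (G\<^sub>i - G\<^sub>j)\<close> has only nonnegative terms.\<close>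

lemma chebyshev_weighted:
  fixes F G v :: "nat \<Rightarrow> real"
  assumes "\<And>i. v i \<ge> 0" and F: "\<And>i j. i \<le> j \<Longrightarrow> F j \<le> F i" and G: "\<And>i j. i \<le> j \<Longrightarrow> G j \<le> G i"
  shows "(\<Sum>i\<le>k. v i * F i) * (\<Sum>i\<le>k. v i * G i) \<le> (\<Sum>i\<le>k. v i) * (\<Sum>i\<le>k. v i * (F i * G i))"
proof -
  have "(F i - F j) * (G i - G j) \<ge> 0" for i j
    using F[of i j] F[of j i] G[of i j] G[of j i] by (cases "i \<le> j") (auto simp: zero_le_mult_iff)
  then have "0 \<le> (\<Sum>i\<le>k. \<Sum>j\<le>k. v i * v j * ((F i - F j) * (G i - G j)))"
    using assms(1) by (intro sum_nonneg mult_nonneg_nonneg[OF mult_nonneg_nonneg]) auto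
  also have "\<dots> = (\<Sum>i\<le>k. \<Sum>j\<le>k. v i * (F i * G i) * v j) + (\<Sum>i\<le>k. \<Sum>j\<le>k. v i * (v j * (F j * G j)))
     - (\<Sum>i\<le>k. \<Sum>j\<le>k. (v i * F i) * (v j * G j)) - (\<Sum>i\<le>k. \<Sum>j\<le>k. (v i * G i) * (v j * F j))"
    by (simp add: sum.distrib[symmetric] sum_subtractf[symmetric] algebra_simps)
  also have "\<dots> = 2 * ((\<Sum>i\<le>k. v i) * (\<Sum>i\<le>k. v i * (F i * G i)) - (\<Sum>i\<le>k. v i * F i) * (\<Sum>i\<le>k. v i * G i))"
    unfolding sum_product[symmetric] by simp
  finally show ?thesis by simp
qed

lemma sum_divisors_prime_power_mult:
  fixes h :: "nat \<Rightarrow> real"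
  assumes p: "prime p" and "\<not> p dvd m" and "m > 0"
  shows "(\<Sum>d | d dvd p ^ k * m. h d) = (\<Sum>i\<le>k. \<Sum>e | e dvd m. h (p ^ i * e))"
proof -
  have cop: "coprime (p ^ i) e" if "e dvd m" for i e
    using p that assms(2) by (meson coprime_power_left_iff dvd_trans prime_imp_coprime)
  have "bij_betw (\<lambda>(i, e). p ^ i * e) ({..k} \<times> {e. e dvd m}) {d. d dvd p ^ k * m}"
  proof (rule bij_betw_imageI)
    show "inj_on (\<lambda>(i, e). p ^ i * e) ({..k} \<times> {e. e dvd m})"
    proof (rule inj_onI, clarify)
      fix i e j f assume *: "e dvd m" "f dvd m" "p ^ i * e = p ^ j * f"
      have "p ^ i dvd p ^ j" "p ^ j dvd p ^ i"
        using *(3) cop[OF *(1), of j] cop[OF *(2), of i]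
        by (metis coprime_dvd_mult_left_iff dvd_triv_left cop[OF *(2)] cop[OF *(1)])+
      then have "p ^ i = p ^ j" by (rule dvd_antisym)
      moreover from this have "i = j" using prime_gt_1_nat[OF p] by simp
      ultimately show "i = j \<and> e = f" using * p by (simp add: prime_gt_0_nat)
    qed
    show "(\<lambda>(i, e). p ^ i * e) ` ({..k} \<times> {e. e dvd m}) = {d. d dvd p ^ k * m}" (is "?L = ?R")
    proof
      show "?L \<subseteq> ?R" by (auto intro!: mult_dvd_mono le_imp_power_dvd)
      show "?R \<subseteq> ?L"
      proof
        fix d assume "d \<in> ?R"
        then obtain x y where "d = x * y" "x dvd p ^ k" "y dvd m"
          using division_decomp[of d "p ^ k" m] by auto
        then show "d \<in> ?L" using divides_primepow_nat[OF p] by force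
      qed
    qed
  qed
  then have "(\<Sum>d | d dvd p ^ k * m. h d) = (\<Sum>(i, e)\<in>{..k} \<times> {e. e dvd m}. h (p ^ i * e))"
    by (simp add: sum.reindex_bij_betw[symmetric] case_prod_unfold)
  also have "\<dots> = (\<Sum>i\<le>k. \<Sum>e | e dvd m. h (p ^ i * e))"
    using assms(3) by (subst sum.cartesian_product[symmetric]) auto
  finally show ?thesis .
qed

definition dvd_antitone :: "(nat \<Rightarrow> real) \<Rightarrow> bool" where
  "dvd_antitone f \<longleftrightarrow> (\<forall>x y. x dvd y \<longrightarrow> f y \<le> f x)"

text \<open>Harris' inequality on the divisor lattice of \<open>q\<close>, a product of chains, for a completely multiplicative
weight. The induction splits off one prime power \<open>p\<^sup>k\<close>: the induction hypothesis handles the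
cofactor for each fixed power of \<open>p\<close>, and Chebyshev's inequality handles the remaining chain of powers.\<close>

lemma divisor_correlation:
  fixes f g w :: "nat \<Rightarrow> real"
  assumes w: "\<And>x y. w (x * y) = w x * w y" "\<And>x. w x \<ge> 0"
    and "dvd_antitone f" "dvd_antitone g" "q > 0"
  shows "(\<Sum>d | d dvd q. w d * f d) * (\<Sum>d | d dvd q. w d * g d)
       \<le> (\<Sum>d | d dvd q. w d) * (\<Sum>d | d dvd q. w d * (f d * g d))"
  using assms(3-5)
proof (induction q arbitrary: f g rule: less_induct)
  case (less q)
  show ?case
  proof (cases "q = 1")
    case True
    then show ?thesis by (simp add: algebra_simps)
  next
    case False
    then obtain p where p: "prime p" "p dvd q" using prime_factor_nat by blast
    define k where "k = multiplicity p q"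
    define m where "m = q div p ^ k"
    have q: "q = p ^ k * m" unfolding m_def k_def by (simp add: multiplicity_dvd)
    have m: "m > 0" using less.prems q by (cases "m = 0") auto
    have pm: "\<not> p dvd m"
      unfolding m_def k_def using less.prems p by (intro multiplicity_decompose) auto
    have "k > 0" unfolding k_def using p less.prems by (simp add: prime_multiplicity_gt_zero_iff)
    then have "p ^ k > 1" using prime_gt_1_nat[OF p(1)] by (intro one_less_power)
    then have mq: "m < q" unfolding q using m by simp
    have [simp]: "finite {d. d dvd m}" using m by simp
    define F where "F i = (\<Sum>e | e dvd m. w e * f (p ^ i * e))" for i
    define G where "G i = (\<Sum>e | e dvd m. w e * g (p ^ i * e))" for i
    define H where "H i = (\<Sum>e | e dvd m. w e * (f (p ^ i * e) * g (p ^ i * e)))" for i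
    define W where "W = (\<Sum>e | e dvd m. w e)"
    define v where "v i = w (p ^ i)" for i
    have anti: "dvd_antitone (\<lambda>e. h (p ^ i * e))" if "dvd_antitone h" for h i
      using that by (auto simp: dvd_antitone_def)
    have IH: "F i * G i \<le> W * H i" for i
      unfolding F_def G_def H_def W_def
      using less.IH[OF mq anti[OF less.prems(1)] anti[OF less.prems(2)] m] .
    have decr: "(\<Sum>e | e dvd m. w e * h (p ^ j * e)) \<le> (\<Sum>e | e dvd m. w e * h (p ^ i * e))"
      if "dvd_antitone h" "i \<le> j" for h i j
      using that w(2) by (intro sum_mono mult_left_mono)
        (auto simp: dvd_antitone_def le_imp_power_dvd)
    have expand: "(\<Sum>d | d dvd q. w d * h d) = (\<Sum>i\<le>k. v i * (\<Sum>e | e dvd m. w e * h (p ^ i * e)))" for h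
      unfolding q sum_divisors_prime_power_mult[OF p(1) pm m] v_def
      by (simp add: w(1) sum_distrib_left mult.assoc)
    have W: "(\<Sum>d | d dvd q. w d) = (\<Sum>i\<le>k. v i) * W"
      using expand[of "\<lambda>_. 1"] by (simp add: W_def sum_distrib_right)
    have "(\<Sum>d | d dvd q. w d * f d) * (\<Sum>d | d dvd q. w d * g d)
          = (\<Sum>i\<le>k. v i * F i) * (\<Sum>i\<le>k. v i * G i)"
      by (simp add: expand F_def G_def)
    also have "\<dots> \<le> (\<Sum>i\<le>k. v i) * (\<Sum>i\<le>k. v i * (F i * G i))"
      using decr[OF less.prems(1)] decr[OF less.prems(2)] w(2)
      by (intro chebyshev_weighted) (auto simp: F_def G_def v_def)
    also have "\<dots> \<le> (\<Sum>i\<le>k. v i) * (\<Sum>i\<le>k. v i * (W * H i))"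
      using IH w(2) by (intro mult_left_mono sum_mono sum_nonneg) (auto simp: v_def)
    also have "\<dots> = (\<Sum>i\<le>k. v i) * W * (\<Sum>i\<le>k. v i * H i)"
      by (simp add: sum_distrib_left mult_ac)
    also have "\<dots> = (\<Sum>d | d dvd q. w d) * (\<Sum>d | d dvd q. w d * (f d * g d))"
      by (simp add: W expand H_def)
    finally show ?thesis .
  qed
qed

text \<open>The divisors of \<open>k!\<close> contain \<open>{1..k}\<close>, so they exhaust the positive integers.\<close>

lemma sum_divisors_fact_tendsto:
  fixes a :: "nat \<Rightarrow> real"
  assumes "summable a" "\<And>n. a n \<ge> 0" "a 0 = 0"
  shows "(\<lambda>k. \<Sum>d | d dvd fact k. a d) \<longlonglongrightarrow> suminf a"
proof (rule tendsto_sandwich)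
  show "\<forall>\<^sub>F k in sequentially. (\<Sum>d | d dvd fact k. a d) \<le> suminf a"
    using assms by (intro always_eventually allI sum_le_suminf) auto
  show "\<forall>\<^sub>F k in sequentially. (\<Sum>d<Suc k. a d) \<le> (\<Sum>d | d dvd fact k. a d)"
  proof (intro always_eventually allI)
    fix k
    have "(\<Sum>d<Suc k. a d) = (\<Sum>d\<in>{1..k}. a d)"
      using assms(3) by (intro sum.mono_neutral_right) (auto simp: not_le)
    also have "\<dots> \<le> (\<Sum>d | d dvd fact k. a d)"
      using assms(2) by (intro sum_mono2) (auto intro: dvd_fact)
    finally show "(\<Sum>d<Suc k. a d) \<le> (\<Sum>d | d dvd fact k. a d)" .
  qed
  show "(\<lambda>k. \<Sum>d<Suc k. a d) \<longlonglongrightarrow> suminf a"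
    using summable_LIMSEQ[OF assms(1)] by (rule LIMSEQ_Suc)
qed auto

lemma zeta_correlation:
  fixes f g :: "nat \<Rightarrow> real"
  assumes s: "s > 1" and f: "dvd_antitone f" "\<And>n. 0 \<le> f n" "\<And>n. f n \<le> 1"
    and g: "dvd_antitone g" "\<And>n. 0 \<le> g n" "\<And>n. g n \<le> 1"
  shows "(\<Sum>n. real n powr - s * f n) * (\<Sum>n. real n powr - s * g n)
       \<le> (\<Sum>n. real n powr - s) * (\<Sum>n. real n powr - s * (f n * g n))"
proof -
  have sm: "summable (\<lambda>n. real n powr - s)"
    using s by (simp add: summable_real_powr_iff)
  have lim: "(\<lambda>k. \<Sum>d | d dvd fact k. real d powr - s * h d) \<longlonglongrightarrow> (\<Sum>n. real n powr - s * h n)"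
    if "\<And>n. 0 \<le> h n" "\<And>n. h n \<le> 1" for h
  proof (rule sum_divisors_fact_tendsto)
    show "summable (\<lambda>n. real n powr - s * h n)"
      using that by (intro summable_comparison_test'[OF sm]) (auto simp: abs_mult intro!: mult_left_le)
  qed (use that in auto)
  have "f n * g n \<le> 1" for n using f g by (simp add: mult_le_one)
  then have limfg: "(\<lambda>k. \<Sum>d | d dvd fact k. real d powr - s * (f d * g d)) \<longlonglongrightarrow>
      (\<Sum>n. real n powr - s * (f n * g n))"
    using f g by (intro lim) auto
  have lim1: "(\<lambda>k. \<Sum>d | d dvd fact k. real d powr - s) \<longlonglongrightarrow> (\<Sum>n. real n powr - s)"
    using lim[of "\<lambda>_. 1"] by simp
  show ?thesis
  proof (rule LIMSEQ_le[OF tendsto_mult[OF lim lim] tendsto_mult[OF lim1 limfg]])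
    show "\<exists>N. \<forall>k\<ge>N. (\<Sum>d | d dvd fact k. real d powr - s * f d) * (\<Sum>d | d dvd fact k. real d powr - s * g d)
          \<le> (\<Sum>d | d dvd fact k. real d powr - s) * (\<Sum>d | d dvd fact k. real d powr - s * (f d * g d))"
      using f(1) g(1) by (intro exI allI impI divisor_correlation) (auto simp: powr_mult)
  qed (use f g in auto)
qed

lemma in_free_integers: "n \<in> free_integers B \<longleftrightarrow> (\<forall>b\<in>B. \<not> int b dvd n)"
  by (auto simp: free_integers_def multiples_def)

lemma free_integers_antitone:
  "dvd_antitone (\<lambda>n. of_bool (int n \<in> free_integers B))"
  unfolding dvd_antitone_def in_free_integers
  by (auto simp: of_bool_def intro: dvd_trans)

lemma free_integers_Un: "free_integers (A \<union> D) = free_integers A \<inter> free_integers D"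
  by (auto simp: in_free_integers)

lemma free_integers_mono: "A \<subseteq> D \<Longrightarrow> free_integers D \<subseteq> free_integers A"
  by (fastforce simp: in_free_integers)

lemma freq_correlation:
  assumes "s > 1"
  shows "freq s (free_integers A) * freq s (free_integers D) \<le> freq s (free_integers (A \<union> D))"
proof -
  have "zmass s (free_integers A) * zmass s (free_integers D)
      \<le> zmass s UNIV * zmass s (free_integers (A \<union> D))"
    using zeta_correlation[OF assms free_integers_antitone[of A] _ _ free_integers_antitone[of D]]
    by (simp add: zmass_def free_integers_Un mult.commute of_bool_conj)
  then show ?thesis
    using zmass_UNIV_pos[OF assms] by (simp add: field_simps)
qed

text \<open>Passing from the exponent \<open>t\<close> to \<open>s\<close> multiplies the weights by \<open>n\<^sup>t\<^sup>-\<^sup>s\<close>, a function that decreases along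
divisibility just as the indicator of the \<open>B\<close>-free integers does; by correlation this can only
raise their frequency.\<close>

lemma freq_free_antimono:
  assumes "1 < t" "t \<le> s"
  shows "freq t (free_integers B) \<le> freq s (free_integers B)"
proof -
  let ?f = "\<lambda>n. of_bool (int n \<in> free_integers B) :: real" and ?g = "\<lambda>n. real n powr - (s - t)"
  have g: "dvd_antitone ?g"
    unfolding dvd_antitone_def
  proof (intro allI impI)
    fix x y :: nat assume "x dvd y"
    show "?g y \<le> ?g x"
    proof (cases "y = 0")
      case False
      with \<open>x dvd y\<close> have "0 < x" "x \<le> y" by (auto intro: dvd_imp_le gr0I)
      then show ?thesis using assms by (intro powr_mono2') auto
    qed simp
  qed
  have g1: "?g n \<le> 1" for n
    using assms powr_mono[of "t - s" 0 "real n"] by (cases "n = 0") auto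
  have eq: "real n powr - t * ?g n = real n powr - s" for n
    by (simp flip: powr_add)
  have eq': "real n powr - t * (?f n * ?g n) = ?f n * real n powr - s" for n
    using eq[of n] by (simp add: mult.left_commute)
  have "zmass t (free_integers B) * zmass s UNIV \<le> zmass t UNIV * zmass s (free_integers B)"
    using zeta_correlation[OF assms(1) free_integers_antitone[of B] _ _ g _ g1]
    unfolding eq eq' by (simp add: zmass_def mult.commute)
  then show ?thesis
    using zmass_UNIV_pos[of s] zmass_UNIV_pos[of t] assms by (simp add: field_simps)
qed

lemma periodic_free_integers:
  assumes "\<And>b. b \<in> B \<Longrightarrow> b dvd q"
  shows "periodic q (free_integers B)"
  unfolding periodic_def in_free_integers
  using assms by (simp add: dvd_add_left_iff)

text \<open>Up to \<open>N\<close>, being \<open>B\<close>-free depends only on the elements of \<open>B\<close> up to \<open>N\<close>, and the mass beyond \<open>N\<close> tends to \<open>0\<close>.\<close>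

lemma zmass_free_le:
  assumes s: "s > 1" and c: "\<And>N. c \<le> zmass s (free_integers (B \<inter> {..N}))"
  shows "c \<le> zmass s (free_integers B)"
proof -
  have "zmass s {int N<..} = zmass s UNIV - (\<Sum>n\<le>N. real n powr - s)" for N
  proof -
    have "{int N<..} = UNIV - {..int N}" by auto
    then have "zmass s {int N<..} = zmass s UNIV - zmass s {..int N}"
      using zmass_diff[OF s, of "{..int N}" UNIV] by simp
    also have "zmass s {..int N} = (\<Sum>n\<le>N. of_bool (int n \<in> {..int N}) * real n powr - s)"
      unfolding zmass_def by (rule suminf_finite) auto
    finally show ?thesis by simp
  qed
  moreover have "(\<lambda>N. \<Sum>n\<le>N. real n powr - s) \<longlonglongrightarrow> zmass s UNIV"
    using summable_LIMSEQ'[of "\<lambda>n. real n powr - s"] s by (simp add: summable_real_powr_iff zmass_def)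
  ultimately have "(\<lambda>N. zmass s {int N<..}) \<longlonglongrightarrow> 0"
    by (auto intro!: tendsto_eq_intros)
  then have "(\<lambda>N. zmass s (free_integers B) + zmass s {int N<..}) \<longlonglongrightarrow> zmass s (free_integers B)"
    by (auto intro!: tendsto_eq_intros)
  then show ?thesis
  proof (rule LIMSEQ_le_const, intro exI allI impI)
    fix N :: nat
    have "c \<le> zmass s (free_integers (B \<inter> {..N}))" by (rule c)
    also have "\<dots> \<le> zmass s (free_integers B \<union> {int N<..})"
    proof (rule zmass_mono[OF s])
      fix n assume n: "n \<ge> 1" "n \<in> free_integers (B \<inter> {..N})"
      show "n \<in> free_integers B \<union> {int N<..}"
      proof (cases "n > int N")
        case False
        then have "\<not> int b dvd n" if "b \<in> B" for b
          using n that by (cases "b \<le> N") (auto simp: in_free_integers dest: zdvd_imp_le)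
        then show ?thesis by (auto simp: in_free_integers)
      qed auto
    qed
    also have "\<dots> \<le> zmass s (free_integers B) + zmass s {int N<..}"
      by (rule zmass_Un_le[OF s])
    finally show "c \<le> zmass s (free_integers B) + zmass s {int N<..}" by simp
  qed
qed

section \<open>A random profinite integer\<close>

text \<open>Independent uniform digits \<open>\<omega>\<^sub>j \<in> {0..j}\<close> in the factorial number system: the profinite integer
\<open>\<Sum>\<^sub>j \<omega>\<^sub>j j!\<close> is then uniformly distributed. Its residue modulo \<open>b\<close> depends on the first \<open>b\<close> digits
only, since \<open>b\<close> divides \<open>j!\<close> for \<open>j \<ge> b\<close>.\<close>

definition profinite :: "(nat \<Rightarrow> nat) measure" where
  "profinite = PiM UNIV (\<lambda>j. measure_pmf (pmf_of_set {..j}))"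

definition residue :: "nat \<Rightarrow> (nat \<Rightarrow> nat) \<Rightarrow> int" where
  "residue b \<omega> = int (\<Sum>j<b. \<omega> j * fact j) mod int b"

lemma prob_space_profinite: "prob_space profinite"
  unfolding profinite_def by (rule prob_space_PiM) (rule prob_space_measure_pmf)

interpretation profinite: prob_space profinite
  by (rule prob_space_profinite)

lemma space_profinite [simp]: "space profinite = UNIV"
  by (simp add: profinite_def space_PiM)

lemma residue_bounds: "b > 0 \<Longrightarrow> residue b \<omega> \<in> {0..<int b}"
  by (simp add: residue_def)

lemma residue_mod:
  assumes "b dvd q" "q > 0"
  shows "residue q \<omega> mod int b = residue b \<omega>"
proof -
  have bq: "b \<le> q" using assms by (auto intro: dvd_imp_le)
  have "residue q \<omega> mod int b = int (\<Sum>j<q. \<omega> j * fact j) mod int b"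
    using assms by (simp add: residue_def mod_mod_cancel)
  also have "\<dots> = int ((\<Sum>j<q. \<omega> j * fact j) mod b)"
    by (simp add: zmod_int)
  also have "(\<Sum>j<q. \<omega> j * fact j) = (\<Sum>j<b. \<omega> j * fact j) + (\<Sum>j\<in>{b..<q}. \<omega> j * fact j)"
    using bq by (subst sum.union_disjoint[symmetric]) (auto intro!: sum.cong)
  also have "b dvd (\<Sum>j\<in>{b..<q}. \<omega> j * fact j)"
    using assms by (intro dvd_sum dvd_mult dvd_fact) (auto simp: Suc_le_eq intro: gr0I)
  then have "((\<Sum>j<b. \<omega> j * fact j) + (\<Sum>j\<in>{b..<q}. \<omega> j * fact j)) mod b = (\<Sum>j<b. \<omega> j * fact j) mod b"
    by (metis add.right_neutral mod_add_right_eq mod_0_imp_dvd dvd_imp_mod_0)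
  finally show ?thesis by (simp add: residue_def zmod_int)
qed

lemma measurable_residue [measurable]: "residue b \<in> measurable profinite (count_space UNIV)"
proof -
  have *: "(\<lambda>\<omega>. \<Sum>j<k. \<omega> j * fact j) \<in> measurable profinite (count_space UNIV)" for k
  proof (induction k)
    case (Suc k)
    have "(\<lambda>\<omega>. \<omega> k) \<in> measurable profinite (measure_pmf (pmf_of_set {..k}))"
      unfolding profinite_def by (rule measurable_component_singleton) simp
    moreover have "sets (measure_pmf (pmf_of_set {..k})) = sets (count_space UNIV)"
      by simp
    ultimately have c: "(\<lambda>\<omega>. \<omega> k) \<in> measurable profinite (count_space UNIV)"
      using measurable_cong_sets by blast
    have "(\<lambda>\<omega>. n + \<omega> k * fact k) \<in> measurable profinite (count_space UNIV)" for n
      using measurable_compose[OF c, of "\<lambda>x. n + x * fact k"] by simp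
    from measurable_compose_countable'[OF this Suc] show ?case by simp
  qed simp
  show ?thesis
    unfolding residue_def
    using measurable_compose[OF *[of b], of "\<lambda>x. int x mod int b" "count_space UNIV"] by simp
qed

lemma sets_residue [measurable]: "{\<omega>. P (residue b \<omega>)} \<in> sets profinite"
proof -
  have "Measurable.pred profinite (\<lambda>\<omega>. P (residue b \<omega>))" by measurable
  then show ?thesis by (simp add: pred_def)
qed

lemma factorial_digits: "(\<Sum>j<k. (n div fact j mod Suc j) * fact j) = n mod fact k"
  for n :: nat
proof (induction k)
  case (Suc k)
  have "n mod fact (Suc k) = n mod (fact k * Suc k)" by (simp add: mult.commute)
  also have "\<dots> = fact k * (n div fact k mod Suc k) + n mod fact k" by (rule mod_mult2_eq)
  finally show ?case using Suc by simp
qed simp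

text \<open>Prescribing the first \<open>q\<close> digits has probability \<open>1 / q!\<close> and fixes the residue modulo \<open>q\<close>. There are
\<open>q! / q\<close> such prescriptions for each residue, so every residue has probability at least \<open>1 / q\<close>; as the \<open>q\<close>
probabilities sum to \<open>1\<close>, equality holds throughout.\<close>

lemma prob_residue:
  assumes "q > 0"
  shows "profinite.prob {\<omega>. residue q \<omega> \<in> S} = card (S \<inter> {0..<int q}) / q"
proof -
  define box where "box n = {\<omega>::nat \<Rightarrow> nat. \<forall>j\<in>{..<q}. \<omega> j \<in> {n div fact j mod Suc j}}" for n :: nat
  interpret P: product_prob_space "\<lambda>j. measure_pmf (pmf_of_set {..j})" "UNIV :: nat set"
    by unfold_locales
  have box: "emeasure profinite (box n) = ennreal (1 / fact q)" for n
  proof -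
    have "emeasure profinite (box n) = (\<Prod>j<q. emeasure (measure_pmf (pmf_of_set {..j})) {n div fact j mod Suc j})"
      using P.emeasure_PiM_Collect[of "{..<q}" "\<lambda>j. {n div fact j mod Suc j}"]
      by (simp add: profinite_def box_def space_PiM)
    also have "\<dots> = (\<Prod>j<q. ennreal (1 / real (Suc j)))"
    proof (rule prod.cong)
      fix j
      have "n div fact j mod Suc j \<le> j" using mod_less_divisor[of "Suc j"] by (simp add: less_Suc_eq_le)
      then show "emeasure (measure_pmf (pmf_of_set {..j})) {n div fact j mod Suc j} = ennreal (1 / real (Suc j))"
        by (simp add: emeasure_pmf_single)
    qed simp
    also have "\<dots> = ennreal (\<Prod>j<q. 1 / real (Suc j))" by (rule prod_ennreal) simp
    also have "(\<Prod>j<q. 1 / real (Suc j)) = 1 / fact q"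
      by (induction q) (simp_all add: mult.commute)
    finally show ?thesis .
  qed
  have box_sets: "box n \<in> sets profinite" for n
  proof (rule ccontr)
    assume "box n \<notin> sets profinite"
    then have "ennreal (1 / fact q) = 0" using box[of n] by (simp add: emeasure_notin_sets)
    then have "1 / fact q \<le> (0 :: real)" by (simp only: ennreal_eq_0_iff)
    moreover have "1 / fact q > (0 :: real)" by simp
    ultimately show False by linarith
  qed
  have box_prob: "profinite.prob (box n) = 1 / fact q" for n
    using box[of n] by (simp add: measure_def)
  have box_residue: "residue q \<omega> = int (n mod q)" if "\<omega> \<in> box n" for \<omega> n
  proof -
    have "(\<Sum>j<q. \<omega> j * fact j) = (\<Sum>j<q. (n div fact j mod Suc j) * fact j)"
      using that by (intro sum.cong) (auto simp: box_def)
    also have "\<dots> = n mod fact q" by (rule factorial_digits)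
    finally show ?thesis
      using assms dvd_fact[of q q] by (simp add: residue_def zmod_int[symmetric] mod_mod_cancel del: of_nat_mod of_nat_sum)
  qed
  have box_disj: "m = n" if "\<omega> \<in> box m" "\<omega> \<in> box n" "m < fact q" "n < fact q" for \<omega> m n
  proof -
    have "(\<Sum>j<q. (m div fact j mod Suc j) * fact j) = (\<Sum>j<q. (n div fact j mod Suc j) * fact j)"
      using that by (intro sum.cong) (auto simp: box_def)
    then show ?thesis using that unfolding factorial_digits by simp
  qed
  have lower: "1 / q \<le> profinite.prob {\<omega>. residue q \<omega> = r}" if r: "r \<in> {0..<int q}" for r
  proof -
    \<comment> \<open>The numbers below \<open>q!\<close> that are congruent to \<open>r\<close> modulo \<open>q\<close>.\<close>
    define J where "J = (\<lambda>i. nat r + q * i) ` {..<fact q div q}"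
    have qf: "q * (fact q div q) = fact q" using assms dvd_fact[of q q] by simp
    have J: "n < fact q \<and> n mod q = nat r" if n: "n \<in> J" for n
    proof -
      obtain i where i: "i < fact q div q" "n = nat r + q * i" using n by (auto simp: J_def)
      have "n < q + q * i" using r i by auto
      also have "\<dots> \<le> q * (fact q div q)" using i(1) by (metis Suc_leI mult_Suc_right mult_le_mono2)
      finally show ?thesis using i(2) r qf by auto
    qed
    have "card J = fact q div q"
      unfolding J_def using assms by (subst card_image) (auto simp: inj_on_def)
    then have "1 / real q = (\<Sum>n\<in>J. profinite.prob (box n))"
      using qf assms by (simp add: box_prob field_simps flip: of_nat_mult)
    also have "\<dots> = profinite.prob (\<Union>n\<in>J. box n)"
    proof (intro profinite.finite_measure_finite_Union[symmetric])
      show "disjoint_family_on box J"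
        using box_disj J unfolding disjoint_family_on_def by blast
    qed (use box_sets in \<open>auto simp: J_def\<close>)
    also have "\<dots> \<le> profinite.prob {\<omega>. residue q \<omega> = r}"
      using box_residue J r by (intro profinite.finite_measure_mono) auto
    finally show ?thesis .
  qed
  have sum: "(\<Sum>r\<in>T. profinite.prob {\<omega>. residue q \<omega> = r}) = profinite.prob {\<omega>. residue q \<omega> \<in> T}"
    if "finite T" for T
  proof -
    have "{\<omega>. residue q \<omega> \<in> T} = (\<Union>r\<in>T. {\<omega>. residue q \<omega> = r})" by auto
    then show ?thesis
      using that sets_residue[of "\<lambda>x. x = _" q]
      by (simp only:, subst profinite.finite_measure_finite_Union)
         (auto simp: disjoint_family_on_def)
  qed
  have "(\<Sum>r\<in>{0..<int q}. profinite.prob {\<omega>. residue q \<omega> = r}) = 1"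
    using sum[of "{0..<int q}"] residue_bounds[OF assms] profinite.prob_space by simp
  also have "\<dots> = (\<Sum>r\<in>{0..<int q}. 1 / real q)" using assms by simp
  finally have "(\<Sum>r\<in>{0..<int q}. profinite.prob {\<omega>. residue q \<omega> = r} - 1 / real q) = 0"
    by (simp add: sum_subtractf)
  then have eq: "profinite.prob {\<omega>. residue q \<omega> = r} = 1 / real q" if "r \<in> {0..<int q}" for r
    using lower that by (subst (asm) sum_nonneg_eq_0_iff) auto
  have "{\<omega>. residue q \<omega> \<in> S} = {\<omega>. residue q \<omega> \<in> S \<inter> {0..<int q}}"
    using residue_bounds[OF assms] by auto
  then show ?thesis using sum[of "S \<inter> {0..<int q}"] eq by simp
qed

lemma freq_tendsto_prob:
  assumes "periodic q S" "q > 0"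
  shows "((\<lambda>s. freq s S) \<longlongrightarrow> profinite.prob {\<omega>. residue q \<omega> \<in> S}) (at_right 1)"
  using freq_periodic_tendsto[OF assms] prob_residue[OF assms(2)] by simp

section \<open>Sieving the random profinite integer\<close>

text \<open>The value at \<open>n\<close> says whether \<open>\<omega> + n\<close> is \<open>B\<close>-free; the law of this random sequence is the Mirsky measure.\<close>

definition sieve :: "nat set \<Rightarrow> (nat \<Rightarrow> nat) \<Rightarrow> biseq" where
  "sieve B \<omega> = (\<lambda>n. \<forall>b\<in>B. \<not> int b dvd residue b \<omega> + n)"

lemma sieve_finite:
  assumes "\<And>b. b \<in> B \<Longrightarrow> b dvd q" "q > 0"
  shows "sieve B \<omega> n \<longleftrightarrow> residue q \<omega> + n \<in> free_integers B"
proof -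
  have "int b dvd residue b \<omega> + n \<longleftrightarrow> int b dvd residue q \<omega> + n" if "b \<in> B" for b
    using residue_mod[OF assms(1)[OF that] assms(2), of \<omega>]
    by (metis mod_add_left_eq mod_0_imp_dvd dvd_imp_mod_0)
  then show ?thesis by (simp add: sieve_def in_free_integers)
qed

lemma measurable_sieve [measurable]: "Measurable.pred profinite (\<lambda>\<omega>. sieve B \<omega> n)"
proof -
  have "countable B" by simp
  then show ?thesis unfolding sieve_def by measurable
qed

lemma sieve_truncate: "sieve B \<omega> n \<longleftrightarrow> (\<forall>N. sieve (B \<inter> {..N}) \<omega> n)"
  by (auto simp: sieve_def)

text \<open>The random counterpart of the set \<open>sieve_set\<close> of integers below, to which it reduces modulo a common period
when \<open>B\<close> is finite. The choice \<open>a = 1\<close> imposes no congruence.\<close>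

definition sieve_event :: "nat \<Rightarrow> int \<Rightarrow> int set \<Rightarrow> nat set \<Rightarrow> (nat \<Rightarrow> nat) set" where
  "sieve_event a r I B = {\<omega>. residue a \<omega> = r mod int a \<and> (\<forall>i\<in>I. sieve B \<omega> i)}"

lemma sets_sieve_event [measurable]: "sieve_event a r I B \<in> sets profinite"
proof -
  have "countable I" by simp
  then have "Measurable.pred profinite (\<lambda>\<omega>. residue a \<omega> = r mod int a \<and> (\<forall>i\<in>I. sieve B \<omega> i))"
    by measurable
  then show ?thesis by (simp add: sieve_event_def pred_def)
qed

lemma sieve_event_antimono: "A \<subseteq> B \<Longrightarrow> sieve_event a r I B \<subseteq> sieve_event a r I A"
  by (auto simp: sieve_event_def sieve_def)

lemma prob_sieve_event_limit:
  "(\<lambda>N. profinite.prob (sieve_event a r I (B \<inter> {..N}))) \<longlonglongrightarrow> profinite.prob (sieve_event a r I B)"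
proof -
  have "(\<Inter>N. sieve_event a r I (B \<inter> {..N})) = sieve_event a r I B"
    using sieve_truncate[of B] by (auto simp: sieve_event_def)
  moreover have "decseq (\<lambda>N. sieve_event a r I (B \<inter> {..N}))"
    by (auto simp: decseq_def sieve_event_def sieve_def)
  ultimately show ?thesis
    using profinite.finite_Lim_measure_decseq[of "\<lambda>N. sieve_event a r I (B \<inter> {..N})"]
    by (auto simp: image_subset_iff)
qed

definition sieve_set :: "nat \<Rightarrow> int \<Rightarrow> int set \<Rightarrow> nat set \<Rightarrow> int set" where
  "sieve_set a r I B = {n. n mod int a = r mod int a \<and> (\<forall>i\<in>I. n + i \<in> free_integers B)}"

lemma sieve_event_finite:
  assumes "\<And>b. b \<in> B \<Longrightarrow> b dvd q" "a dvd q" "q > 0"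
  shows "sieve_event a r I B = {\<omega>. residue q \<omega> \<in> sieve_set a r I B}"
  using sieve_finite[OF assms(1,3)] residue_mod[OF assms(2,3)]
  by (auto simp: sieve_event_def sieve_set_def)

lemma periodic_sieve_set:
  assumes "\<And>b. b \<in> B \<Longrightarrow> b dvd q" "a dvd q"
  shows "periodic q (sieve_set a r I B)"
proof -
  have "(n + int q) mod int a = n mod int a" for n
    using assms(2) by (auto elim!: dvdE)
  moreover have "n + int q + i \<in> free_integers B \<longleftrightarrow> n + i \<in> free_integers B" for n i
    using periodic_free_integers[of B q, OF assms(1), unfolded periodic_def, rule_format, of "n + i"]
    by (simp add: algebra_simps)
  ultimately show ?thesis by (simp add: periodic_def sieve_set_def)
qed

lemma freq_tendsto_prob_sieve:
  assumes "finite B" "B \<subseteq> {1..}" "a > 0"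
  shows "((\<lambda>s. freq s (sieve_set a r I B)) \<longlongrightarrow> profinite.prob (sieve_event a r I B)) (at_right 1)"
proof -
  define q where "q = a * \<Prod>B"
  have q: "q > 0" "a dvd q" "\<And>b. b \<in> B \<Longrightarrow> b dvd q"
    using assms by (auto simp: q_def intro!: prod_pos dvd_mult dvd_prodI)
  show ?thesis
    using freq_tendsto_prob[OF periodic_sieve_set[OF q(3,2)] q(1)] sieve_event_finite[OF q(3,2,1)]
    by simp
qed

lemma sieve_set_1: "sieve_set 1 0 {0} B = free_integers B"
  by (simp add: sieve_set_def)

abbreviation density_free :: "nat set \<Rightarrow> real" where
  "density_free B \<equiv> profinite.prob (sieve_event 1 0 {0} B)"

text \<open>For finite \<open>B\<close> the frequency decreases to the density as \<open>s \<rightarrow> 1\<close>, hence dominates it for every \<open>s\<close>; truncations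
then give the general case. The uniformity in \<open>s\<close> is what controls the tails of infinite sieves.\<close>

lemma freq_ge_density_free:
  assumes B: "B \<subseteq> {1..}" and s: "s > 1"
  shows "density_free B \<le> freq s (free_integers B)"
proof -
  have "density_free B * zmass s UNIV \<le> zmass s (free_integers B)"
  proof (rule zmass_free_le[OF s])
    fix N
    have K: "finite (B \<inter> {..N})" "B \<inter> {..N} \<subseteq> {1..}" using B by auto
    have "density_free (B \<inter> {..N}) \<le> freq s (free_integers (B \<inter> {..N}))"
    proof (rule tendsto_upperbound[OF freq_tendsto_prob_sieve[OF K, of 1 0 "{0}", unfolded sieve_set_1]])
      show "\<forall>\<^sub>F t in at_right 1. freq t (free_integers (B \<inter> {..N})) \<le> freq s (free_integers (B \<inter> {..N}))"
        using eventually_at_right_less[of 1] order_tendstoD(2)[OF tendsto_ident_at s]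
        by eventually_elim (rule freq_free_antimono, auto)
    qed simp_all
    moreover have "density_free B \<le> density_free (B \<inter> {..N})"
      by (intro profinite.finite_measure_mono sieve_event_antimono sets_sieve_event) auto
    ultimately have "density_free B \<le> freq s (free_integers (B \<inter> {..N}))" by simp
    then show "density_free B * zmass s UNIV \<le> zmass s (free_integers (B \<inter> {..N}))"
      using zmass_UNIV_pos[OF s] by (simp add: field_simps)
  qed
  then show ?thesis using zmass_UNIV_pos[OF s] by (simp add: field_simps)
qed

text \<open>Behrend's inequality, obtained from \<open>freq_correlation\<close> by letting first \<open>s \<rightarrow> 1\<close> and then the truncation
level tend to infinity.\<close>

lemma density_free_correlation:
  assumes "A \<subseteq> {1..}" "D \<subseteq> {1..}"
  shows "density_free A * density_free D \<le> density_free (A \<union> D)"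
proof (rule LIMSEQ_le[OF tendsto_mult[OF prob_sieve_event_limit prob_sieve_event_limit] prob_sieve_event_limit],
    intro exI allI impI)
  fix N
  let ?A = "A \<inter> {..N}" and ?D = "D \<inter> {..N}"
  have fin: "finite ?A" "?A \<subseteq> {1..}" "finite ?D" "?D \<subseteq> {1..}" using assms by auto
  have eq: "(A \<union> D) \<inter> {..N} = ?A \<union> ?D" by auto
  show "density_free ?A * density_free ?D \<le> density_free ((A \<union> D) \<inter> {..N})"
    unfolding eq
  proof (rule tendsto_le[OF trivial_limit_at_right_real])
    show "((\<lambda>s. freq s (free_integers (?A \<union> ?D))) \<longlongrightarrow> density_free (?A \<union> ?D)) (at_right 1)"
      using freq_tendsto_prob_sieve[of "?A \<union> ?D" 1 0 "{0}", unfolded sieve_set_1] fin by simp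
    show "((\<lambda>s. freq s (free_integers ?A) * freq s (free_integers ?D)) \<longlongrightarrow> density_free ?A * density_free ?D) (at_right 1)"
      using freq_tendsto_prob_sieve[of ?A 1 0 "{0}", unfolded sieve_set_1]
        freq_tendsto_prob_sieve[of ?D 1 0 "{0}", unfolded sieve_set_1] fin
      by (intro tendsto_mult) simp_all
    show "\<forall>\<^sub>F s in at_right 1. freq s (free_integers ?A) * freq s (free_integers ?D)
        \<le> freq s (free_integers (?A \<union> ?D))"
      using eventually_at_right_less[of 1] by eventually_elim (rule freq_correlation)
  qed
qed

text \<open>If no integer shows the pattern, then each integer showing the pattern of a truncation \<open>K\<close> is, up to a
translation by some \<open>i \<in> I\<close>, a \<open>K\<close>-free integer that is not \<open>B\<close>-free. The frequency of the latter is at most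
\<open>freq s (free_integers K) - density_free B\<close>, which tends to \<open>density_free K - density_free B\<close> for \<open>s \<rightarrow> 1\<close> and so is
arbitrarily small for large \<open>K\<close>.\<close>

lemma sieve_transfer:
  assumes B: "B \<subseteq> {1..}" and a: "a > 0" and I: "finite I"
    and pos: "profinite.prob (sieve_event a r (int ` I) B) > 0"
  shows "\<exists>m. m \<in> sieve_set a r (int ` I) B"
proof (rule ccontr)
  assume none: "\<nexists>m. m \<in> sieve_set a r (int ` I) B"
  let ?E = "\<lambda>B. sieve_event a r (int ` I) B"
  have "profinite.prob (?E B) \<le> card I * (density_free (B \<inter> {..N}) - density_free B)" for N
  proof -
    define K where "K = B \<inter> {..N}"
    have K: "finite K" "K \<subseteq> {1..}" "K \<subseteq> B" using B by (auto simp: K_def)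
    have bound: "freq s (sieve_set a r (int ` I) K)
        \<le> card I * (freq s (free_integers K) - density_free B) + (\<Sum>i\<in>I. 2 * real i) * (s - 1)"
      if s: "s > 1" for s
    proof -
      let ?Z = "zmass s UNIV" and ?D = "free_integers K - free_integers B"
      have Z: "?Z > 0" by (rule zmass_UNIV_pos[OF s])
      have D: "zmass s ?D = zmass s (free_integers K) - zmass s (free_integers B)"
        by (intro zmass_diff s free_integers_mono K)
      have "zmass s (sieve_set a r (int ` I) K) \<le> zmass s (\<Union>i\<in>I. {m. m + int i \<in> ?D})"
        using none by (intro zmass_mono s) (auto simp: sieve_set_def)
      also have "\<dots> \<le> (\<Sum>i\<in>I. zmass s {m. m + int i \<in> ?D})"
        by (rule zmass_UN_le[OF s I])
      also have "\<dots> \<le> (\<Sum>i\<in>I. zmass s ?D + 2 * real i)"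
      proof (rule sum_mono)
        fix i
        show "zmass s {m. m + int i \<in> ?D} \<le> zmass s ?D + 2 * real i"
          using zmass_shift[OF s, of i ?D] by linarith
      qed
      also have "\<dots> = card I * zmass s ?D + (\<Sum>i\<in>I. 2 * real i)"
        by (simp add: sum.distrib)
      finally have "freq s (sieve_set a r (int ` I) K) \<le> (card I * zmass s ?D + (\<Sum>i\<in>I. 2 * real i)) / ?Z"
        using Z by (simp add: divide_right_mono)
      also have "\<dots> = card I * (freq s (free_integers K) - freq s (free_integers B)) + (\<Sum>i\<in>I. 2 * real i) * (1 / ?Z)"
        unfolding D by (simp add: add_divide_distrib diff_divide_distrib right_diff_distrib)
      also have "\<dots> \<le> card I * (freq s (free_integers K) - density_free B) + (\<Sum>i\<in>I. 2 * real i) * (s - 1)"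
        using freq_ge_density_free[OF B s] zeta_bounds(1)[OF s] s Z
        by (intro add_mono mult_left_mono sum_nonneg) (auto simp: field_simps)
      finally show ?thesis .
    qed
    have "profinite.prob (?E K) \<le> card I * (density_free K - density_free B) + (\<Sum>i\<in>I. 2 * real i) * (1 - 1)"
    proof (rule tendsto_le[OF trivial_limit_at_right_real _ freq_tendsto_prob_sieve[OF K(1,2) a]])
      show "((\<lambda>s. card I * (freq s (free_integers K) - density_free B) + (\<Sum>i\<in>I. 2 * real i) * (s - 1))
          \<longlongrightarrow> card I * (density_free K - density_free B) + (\<Sum>i\<in>I. 2 * real i) * (1 - 1)) (at_right 1)"
        using freq_tendsto_prob_sieve[OF K(1,2), of 1 0 "{0}"] unfolding sieve_set_1
        by (intro tendsto_intros) auto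
      show "\<forall>\<^sub>F s in at_right 1. freq s (sieve_set a r (int ` I) K)
          \<le> card I * (freq s (free_integers K) - density_free B) + (\<Sum>i\<in>I. 2 * real i) * (s - 1)"
        using eventually_at_right_less[of 1] by eventually_elim (rule bound)
    qed
    moreover have "profinite.prob (?E B) \<le> profinite.prob (?E K)"
      by (intro profinite.finite_measure_mono sieve_event_antimono sets_sieve_event K)
    ultimately show ?thesis by (simp add: K_def)
  qed
  moreover have "(\<lambda>N. card I * (density_free (B \<inter> {..N}) - density_free B)) \<longlonglongrightarrow>
      card I * (density_free B - density_free B)"
    by (intro tendsto_intros prob_sieve_event_limit)
  ultimately have "profinite.prob (?E B) \<le> card I * (density_free B - density_free B)"
    by (intro LIMSEQ_le_const) auto
  with pos show False by simp
qed

section \<open>Taut sets\<close>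

text \<open>The logarithmic density is a \<open>lim\<close>, which is a definite description of the limit; two sequences whose difference tends to \<open>0\<close> have
the same limits, hence the same \<open>lim\<close> even without convergence.\<close>

lemma log_density_cong:
  assumes "(\<lambda>N::nat. (\<Sum>a\<in>A \<inter> {1..int N}. 1 / real_of_int a) / ln (real N)
      - (\<Sum>a\<in>A' \<inter> {1..int N}. 1 / real_of_int a) / ln (real N)) \<longlonglongrightarrow> 0"
  shows "log_density A = log_density A'"
proof -
  define f where "f A N = (\<Sum>a\<in>A \<inter> {1..int N}. 1 / real_of_int a) / ln (real N)" for A and N :: nat
  have d: "(\<lambda>N. f A N - f A' N) \<longlonglongrightarrow> 0" using assms by (simp add: f_def)
  have "f A \<longlonglongrightarrow> L \<longleftrightarrow> f A' \<longlonglongrightarrow> L" for L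
    using tendsto_diff[OF _ d, of "f A" L] tendsto_add[OF _ d, of "f A'" L] by auto
  then show ?thesis unfolding log_density_def lim_def f_def[symmetric] by simp
qed

text \<open>With \<open>s = 1 + 1 / ln N\<close> the factor \<open>a\<^sup>s\<^sup>-\<^sup>1\<close> is at most \<open>e\<close> for all \<open>a \<le> N\<close>.\<close>

lemma log_sum_le_zmass:
  assumes "N \<ge> 3"
  shows "(\<Sum>a\<in>U \<inter> {1..int N}. 1 / real_of_int a) \<le> exp 1 * zmass (1 + 1 / ln (real N)) U"
proof -
  have lnN: "ln (real N) > 0" using assms by simp
  define s where "s = 1 + 1 / ln (real N)"
  have s: "s > 1" using lnN by (simp add: s_def)
  have le: "1 / real n \<le> exp 1 * real n powr - s" if "n \<in> {1..N}" for n
  proof -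
    have "real n powr (1 / ln (real N)) = exp (ln (real n) / ln (real N))"
      using that by (simp add: powr_def)
    also have "\<dots> \<le> exp 1" using that lnN by simp
    finally have "real n powr (1 / ln (real N)) \<le> exp 1" .
    then have "real n powr - s * real n powr (1 / ln (real N)) \<le> real n powr - s * exp 1"
      by (intro mult_left_mono) auto
    moreover have "real n powr - s * real n powr (1 / ln (real N)) = real n powr (- 1)"
      by (simp add: s_def flip: powr_add)
    ultimately show ?thesis using that by (simp add: powr_minus_divide mult.commute)
  qed
  have "(\<Sum>a\<in>U \<inter> {1..int N}. 1 / real_of_int a) = (\<Sum>n\<in>{n\<in>{1..N}. int n \<in> U}. 1 / real n)"
    by (rule sum.reindex_bij_witness[of _ int nat]) auto
  also have "\<dots> = (\<Sum>n\<in>{1..N}. of_bool (int n \<in> U) * (1 / real n))"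
    by (rule sum.mono_neutral_cong_left) auto
  also have "\<dots> \<le> (\<Sum>n\<in>{1..N}. exp 1 * (of_bool (int n \<in> U) * real n powr - s))"
    using le by (intro sum_mono) auto
  also have "\<dots> = exp 1 * (\<Sum>n\<in>{1..N}. of_bool (int n \<in> U) * real n powr - s)"
    by (rule sum_distrib_left[symmetric])
  also have "\<dots> \<le> exp 1 * zmass s U"
    unfolding zmass_def by (intro mult_left_mono sum_le_suminf summable_zmass s) auto
  finally show ?thesis by (simp add: s_def)
qed

lemma log_density_diff_null:
  assumes "A' \<subseteq> A" and null: "((\<lambda>s. freq s (A - A')) \<longlongrightarrow> 0) (at_right 1)"
  shows "log_density A' = log_density A"
proof (rule log_density_cong[symmetric])
  let ?U = "A - A'" and ?s = "\<lambda>N. 1 + 1 / ln (real N)"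
  have ln: "filterlim (\<lambda>N. ln (real N)) at_top sequentially"
    by (intro filterlim_compose[OF ln_at_top] filterlim_real_sequentially)
  have "filterlim ?s (at_right 1) sequentially"
    unfolding filterlim_at
  proof
    show "\<forall>\<^sub>F N in sequentially. ?s N \<in> {1<..} \<and> ?s N \<noteq> 1"
      using eventually_ge_at_top[of "3::nat"] by eventually_elim auto
    have "(\<lambda>N. 1 / ln (real N)) \<longlonglongrightarrow> 0"
      using tendsto_divide_0[OF tendsto_const filterlim_at_top_imp_at_infinity[OF ln]] .
    from tendsto_add[OF tendsto_const this, of 1] show "?s \<longlonglongrightarrow> 1" by simp
  qed
  from filterlim_compose[OF null this]
  have "(\<lambda>N. 2 * exp 1 * freq (?s N) ?U) \<longlonglongrightarrow> 2 * exp 1 * 0"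
    by (intro tendsto_intros)
  then have lim: "(\<lambda>N. 2 * exp 1 * freq (?s N) ?U) \<longlonglongrightarrow> 0" by simp
  show "(\<lambda>N::nat. (\<Sum>a\<in>A \<inter> {1..int N}. 1 / real_of_int a) / ln (real N)
      - (\<Sum>a\<in>A' \<inter> {1..int N}. 1 / real_of_int a) / ln (real N)) \<longlonglongrightarrow> 0"
  proof (rule Lim_null_comparison[OF _ lim], use eventually_ge_at_top[of "3::nat"] in eventually_elim)
    case (elim N)
    have "exp 1 \<le> real N" using elim exp_le by (simp add: order_trans[OF exp_le])
    then have ln1: "ln (real N) \<ge> 1" using elim by (simp add: ln_ge_iff)
    then have s: "?s N > 1" by simp
    have Z: "zmass (?s N) UNIV > 0" by (rule zmass_UNIV_pos[OF s])
    have "zmass (?s N) UNIV \<le> ?s N / (?s N - 1)" by (rule zeta_bounds(2)[OF s])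
    also have "\<dots> = ln (real N) + 1" using ln1 by (simp add: field_simps)
    also have "\<dots> \<le> 2 * ln (real N)" using ln1 by simp
    finally have Zle: "zmass (?s N) UNIV \<le> 2 * ln (real N)" .
    have split: "A \<inter> {1..int N} = (?U \<inter> {1..int N}) \<union> (A' \<inter> {1..int N})" using assms(1) by auto
    have "(\<Sum>a\<in>A \<inter> {1..int N}. 1 / real_of_int a)
       = (\<Sum>a\<in>?U \<inter> {1..int N}. 1 / real_of_int a) + (\<Sum>a\<in>A' \<inter> {1..int N}. 1 / real_of_int a)"
      unfolding split by (rule sum.union_disjoint) auto
    then have eq: "(\<Sum>a\<in>A \<inter> {1..int N}. 1 / real_of_int a) / ln (real N)
        - (\<Sum>a\<in>A' \<inter> {1..int N}. 1 / real_of_int a) / ln (real N)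
        = (\<Sum>a\<in>?U \<inter> {1..int N}. 1 / real_of_int a) / ln (real N)"
      by (simp add: add_divide_distrib)
    have "(\<Sum>a\<in>?U \<inter> {1..int N}. 1 / real_of_int a) \<le> exp 1 * zmass (?s N) ?U"
      by (rule log_sum_le_zmass[OF elim])
    also have "\<dots> = exp 1 * freq (?s N) ?U * zmass (?s N) UNIV" using Z by simp
    also have "\<dots> \<le> exp 1 * freq (?s N) ?U * (2 * ln (real N))"
      using Zle Z zmass_nonneg[OF s] by (intro mult_left_mono) auto
    finally have "(\<Sum>a\<in>?U \<inter> {1..int N}. 1 / real_of_int a) / ln (real N) \<le> 2 * exp 1 * freq (?s N) ?U"
      using ln1 by (simp add: divide_le_eq mult_ac)
    moreover have "0 \<le> (\<Sum>a\<in>?U \<inter> {1..int N}. 1 / real_of_int a) / ln (real N)"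
      using ln1 by (intro divide_nonneg_nonneg sum_nonneg) auto
    ultimately show ?case unfolding eq by simp
  qed
qed

text \<open>If almost no multiple of \<open>b\<close> avoided the multiples of \<open>B - {b}\<close>, then the integers that only \<open>b\<close> contributes would
lie in periodic sets of arbitrarily small density, and removing \<open>b\<close> would not change the
logarithmic density.\<close>

lemma taut_imp_essential:
  assumes "taut B" and B: "B \<subseteq> {1..}" and b: "b \<in> B"
  shows "profinite.prob (sieve_event b 0 {0} (B - {b})) > 0"
proof (rule ccontr)
  assume "\<not> ?thesis"
  then have 0: "profinite.prob (sieve_event b 0 {0} (B - {b})) = 0"
    by (simp add: not_less measure_le_0_iff)
  let ?U = "multiples B - multiples (B - {b})"
  let ?K = "\<lambda>N. (B - {b}) \<inter> {..N}"
  have "((\<lambda>s. freq s ?U) \<longlongrightarrow> 0) (at_right 1)"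
  proof (rule tendstoI)
    fix e :: real assume e: "e > 0"
    have "\<forall>\<^sub>F N in sequentially. profinite.prob (sieve_event b 0 {0} (?K N)) < e"
      using order_tendstoD(2)[OF prob_sieve_event_limit] e unfolding 0[symmetric] by blast
    then obtain N where N: "profinite.prob (sieve_event b 0 {0} (?K N)) < e"
      by (auto simp: eventually_sequentially)
    have lim: "((\<lambda>s. freq s (sieve_set b 0 {0} (?K N))) \<longlongrightarrow> profinite.prob (sieve_event b 0 {0} (?K N))) (at_right 1)"
      using B b by (intro freq_tendsto_prob_sieve) auto
    show "\<forall>\<^sub>F s in at_right 1. dist (freq s ?U) 0 < e"
      using order_tendstoD(2)[OF lim N] eventually_at_right_less[of 1]
    proof eventually_elim
      case (elim s)
      have "zmass s ?U \<le> zmass s (sieve_set b 0 {0} (?K N))"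
        using elim by (intro zmass_mono) (auto simp: multiples_def sieve_set_def in_free_integers)
      then have "freq s ?U \<le> freq s (sieve_set b 0 {0} (?K N))"
        using zmass_UNIV_pos elim by (intro divide_right_mono) (auto intro: less_imp_le)
      moreover have "freq s ?U \<ge> 0"
        using zmass_nonneg elim by simp
      ultimately show ?case using elim by simp
    qed
  qed
  then have "log_density (multiples (B - {b})) = log_density (multiples B)"
    by (intro log_density_diff_null) (auto simp: multiples_def)
  then show False using assms(1) b by (auto simp: taut_def)
qed

text \<open>Among the numbers \<open>d y\<close> with \<open>y \<equiv> r' (mod a')\<close>, those that are \<open>K\<close>-free are governed by the quotients \<open>b / gcd b d\<close>. A
quotient that is not coprime to \<open>a'\<close> divides no such \<open>y\<close>, and sieving by the remaining ones, which form
\<open>D\<close>, is independent of the condition modulo \<open>a'\<close> by the Chinese remainder theorem.\<close>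

lemma density_free_quotient_le:
  fixes r' :: int
  assumes K: "finite K" "K \<subseteq> {1..}" and d: "d > 0" and a': "a' > 0" and cop: "coprime r' (int a')"
  defines "D \<equiv> {c. \<exists>b\<in>K. c = b div gcd b d \<and> coprime c a'}"
  shows "density_free D \<le> real (d * a') * profinite.prob (sieve_event (d * a') (int d * r') {0} K)"
proof -
  let ?S = "sieve_set (d * a') (int d * r') {0} K"
  have Dsub: "D \<subseteq> (\<lambda>b. b div gcd b d) ` K" by (auto simp: D_def)
  have fin: "finite D" using K(1) Dsub by (rule finite_surj)
  have D1: "D \<subseteq> {1..}"
  proof
    fix c assume "c \<in> D"
    then obtain b where "b \<in> K" "c = b div gcd b d" by (auto simp: D_def)
    moreover from this have "b > 0" using K(2) by (auto simp: Suc_le_eq)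
    then have "b div gcd b d > 0" by (simp add: div_greater_zero_iff gcd_le1_nat)
    ultimately show "c \<in> {1..}" by auto
  qed
  define q where "q = \<Prod>D"
  have q: "q > 0" "\<And>c. c \<in> D \<Longrightarrow> c dvd q"
    using D1 fin by (auto simp: q_def Suc_le_eq intro!: prod_pos dvd_prodI)
  have copq: "coprime q a'"
    unfolding q_def by (rule prod_coprime_left) (auto simp: D_def)
  define T where "T = {int d * y | y. [y = r'] (mod int a') \<and> y \<in> free_integers D}"
  have TS: "T \<subseteq> ?S"
  proof
    fix n assume "n \<in> T"
    then obtain y where y: "n = int d * y" "[y = r'] (mod int a')" "y \<in> free_integers D"
      by (auto simp: T_def)
    have "[n = int d * r'] (mod int d * int a')"
      using y(1,2) by (simp add: cong_iff_dvd_diff mult_dvd_mono flip: right_diff_distrib)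
    moreover have "\<not> int b dvd n" if b: "b \<in> K" for b
    proof
      assume "int b dvd n"
      define g where "g = gcd b d"
      define c where "c = b div g"
      have bgc: "b = g * c" by (simp add: c_def g_def)
      have g0: "g > 0" using d by (simp add: g_def)
      have dg: "d = g * (d div g)" by (simp add: g_def)
      have "coprime c (d div g)"
        unfolding c_def g_def using d by (intro div_gcd_coprime) auto
      moreover have "int c dvd int (d div g) * y"
      proof -
        have "int g * int c dvd int g * (int (d div g) * y)"
          using \<open>int b dvd n\<close> unfolding y(1) by (metis bgc dg mult.assoc of_nat_mult)
        then show ?thesis using g0 by simp
      qed
      ultimately have cy: "int c dvd y"
        by (simp add: coprime_dvd_mult_right_iff)
      have "coprime y (int a')"
        using cop y(2) by (metis cong_imp_coprime cong_sym)
      then have "coprime (int c) (int a')"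
        using cy by (meson coprime_divisors dvd_refl)
      then have "c \<in> D" using b by (auto simp: D_def c_def g_def)
      then show False using y(3) cy by (auto simp: in_free_integers)
    qed
    ultimately show "n \<in> ?S" by (simp add: sieve_set_def in_free_integers cong_def)
  qed
  have perT: "periodic (d * a' * q) T"
    unfolding periodic_def
  proof (intro allI)
    fix n
    have sh: "int d * y + int (d * a' * q) * k \<in> T" if "[y = r'] (mod int a')" "y \<in> free_integers D" for y k
    proof -
      have "[y + int a' * (int q * k) = r'] (mod int a')" using that(1) by (simp add: cong_def)
      moreover have "y + int a' * (int q * k) \<in> free_integers D"
        using that(2) q(2) by (auto simp: in_free_integers dvd_add_left_iff)
      moreover have "int d * y + int (d * a' * q) * k = int d * (y + int a' * (int q * k))"
        by (simp add: algebra_simps)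
      ultimately show ?thesis unfolding T_def by blast
    qed
    show "n + int (d * a' * q) \<in> T \<longleftrightarrow> n \<in> T"
    proof
      assume "n \<in> T" then show "n + int (d * a' * q) \<in> T"
        using sh[of _ 1] by (auto simp: T_def)
    next
      assume "n + int (d * a' * q) \<in> T"
      then obtain y where y: "n + int (d * a' * q) = int d * y" "[y = r'] (mod int a')" "y \<in> free_integers D"
        by (auto simp: T_def)
      have "n = int d * y + int (d * a' * q) * (- 1)" using y(1) by simp
      then show "n \<in> T" using sh[OF y(2,3), of "-1"] by simp
    qed
  qed
  have card: "card (free_integers D \<inter> {0..<int q}) \<le> card (T \<inter> {0..<int (d * a' * q)})"
  proof -
    \<comment> \<open>Each \<open>D\<close>-free residue modulo \<open>q\<close> lifts to one that is also \<open>r'\<close> modulo \<open>a'\<close>.\<close>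
    have "\<exists>y. [y = r'] (mod int a') \<and> [y = x] (mod int q)" for x
      using binary_chinese_remainder_int[of "int a'" "int q" r' x] copq by (auto simp: coprime_commute)
    then obtain f where f: "[f x = r'] (mod int a')" "[f x = x] (mod int q)" for x
      by metis
    define h where "h x = int d * (f x mod (int a' * int q))" for x
    have fm: "[f x mod (int a' * int q) = r'] (mod int a')" "[f x mod (int a' * int q) = x] (mod int q)" for x
      using f[of x] by (simp_all add: cong_def mod_mod_cancel)
    show ?thesis
    proof (rule card_inj_on_le)
      show "inj_on h (free_integers D \<inter> {0..<int q})"
      proof (rule inj_onI)
        fix x x' assume x: "x \<in> free_integers D \<inter> {0..<int q}" "x' \<in> free_integers D \<inter> {0..<int q}" "h x = h x'"
        then have "f x mod (int a' * int q) = f x' mod (int a' * int q)" using d by (simp add: h_def)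
        then have "[x = x'] (mod int q)" using fm(2)[of x] fm(2)[of x'] by (simp add: cong_def)
        then show "x = x'" using x by (simp add: cong_def)
      qed
      show "h ` (free_integers D \<inter> {0..<int q}) \<subseteq> T \<inter> {0..<int (d * a' * q)}"
      proof
        fix n assume "n \<in> h ` (free_integers D \<inter> {0..<int q})"
        then obtain x where x: "x \<in> free_integers D" "n = h x" by auto
        let ?y = "f x mod (int a' * int q)"
        have "int c dvd ?y \<longleftrightarrow> int c dvd x" if "c \<in> D" for c
          using q(2)[OF that] fm(2)[of x] by (meson cong_dvd_iff cong_dvd_modulus int_dvd_int_iff)
        then have "?y \<in> free_integers D" using x(1) by (auto simp: in_free_integers)
        then have "n \<in> T" using fm(1)[of x] x(2) by (auto simp: T_def h_def)
        moreover have "?y \<in> {0..<int a' * int q}" using a' q(1) by auto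
        then have "n \<in> {0..<int (d * a' * q)}"
          using d x(2) by (auto simp: h_def mult.assoc)
        ultimately show "n \<in> T \<inter> {0..<int (d * a' * q)}" by simp
      qed
    qed simp
  qed
  have "density_free D = card (free_integers D \<inter> {0..<int q}) / q"
    using sieve_event_finite[of D q 1 0 "{0}", unfolded sieve_set_1] prob_residue[OF q(1), of "free_integers D"] q
    by auto
  also have "\<dots> \<le> card (T \<inter> {0..<int (d * a' * q)}) / q"
    using card by (intro divide_right_mono) auto
  also have "\<dots> = real (d * a') * (card (T \<inter> {0..<int (d * a' * q)}) / (d * a' * q))"
    using d a' by simp
  also have "card (T \<inter> {0..<int (d * a' * q)}) / (d * a' * q) \<le> profinite.prob (sieve_event (d * a') (int d * r') {0} K)"
  proof (rule tendsto_le[OF trivial_limit_at_right_real])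
    show "((\<lambda>s. freq s ?S) \<longlongrightarrow> profinite.prob (sieve_event (d * a') (int d * r') {0} K)) (at_right 1)"
      using K d a' by (intro freq_tendsto_prob_sieve) auto
    show "((\<lambda>s. freq s T) \<longlongrightarrow> card (T \<inter> {0..<int (d * a' * q)}) / (d * a' * q)) (at_right 1)"
      using freq_periodic_tendsto[OF perT] d a' q(1) by simp
    show "\<forall>\<^sub>F s in at_right 1. freq s T \<le> freq s ?S"
      using eventually_at_right_less[of 1]
    proof eventually_elim
      case (elim s)
      then show ?case using TS zmass_UNIV_pos[of s]
        by (intro divide_right_mono zmass_mono) (auto intro: less_imp_le)
    qed
  qed
  then have "real (d * a') * (card (T \<inter> {0..<int (d * a' * q)}) / (d * a' * q))
      \<le> real (d * a') * profinite.prob (sieve_event (d * a') (int d * r') {0} K)"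
    by (intro mult_left_mono) auto
  finally show ?thesis .
qed

lemma density_free_empty: "density_free {} = 1"
proof -
  have "sieve_event 1 0 {0} {} = UNIV"
    by (auto simp: sieve_event_def sieve_def residue_def)
  then show ?thesis using profinite.prob_space by simp
qed

lemma density_free_singleton_pos:
  assumes "c > 1"
  shows "density_free {c} > 0"
proof -
  have "1 \<in> free_integers {c} \<inter> {0..<int c}"
    using assms by (auto simp: in_free_integers)
  then have "card (free_integers {c} \<inter> {0..<int c}) > 0"
    by (auto simp: card_gt_0_iff)
  then show ?thesis
    using sieve_event_finite[of "{c}" c 1 0 "{0}", unfolded sieve_set_1]
      prob_residue[of c "free_integers {c}"] assms by simp
qed

lemma density_free_UN_zero:
  assumes "finite I" "\<And>i. i \<in> I \<Longrightarrow> C i \<subseteq> {1..}" "density_free (\<Union>i\<in>I. C i) = 0"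
  shows "\<exists>i\<in>I. density_free (C i) = 0"
  using assms
proof (induction I rule: finite_induct)
  case empty
  then show ?case using density_free_empty by (metis UN_empty zero_neq_one)
next
  case (insert i I)
  have "density_free (C i) * density_free (\<Union>i\<in>I. C i) \<le> density_free (C i \<union> (\<Union>i\<in>I. C i))"
    using insert.prems(1) by (intro density_free_correlation UN_least) auto
  also have "\<dots> = 0" using insert.prems(2) by simp
  finally have "density_free (C i) = 0 \<or> density_free (\<Union>i\<in>I. C i) = 0"
    by (smt (verit) measure_nonneg mult_pos_pos)
  then show ?case using insert by auto
qed

text \<open>Division by \<open>e\<close> turns multiples of \<open>e\<close> that avoid \<open>e C\<close> into \<open>C\<close>-free numbers.\<close>

lemma sieve_event_scaled_le:
  assumes C: "C \<subseteq> {1..}" and e: "e > 0"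
  shows "profinite.prob (sieve_event e 0 {0} ((\<lambda>c. e * c) ` C)) \<le> density_free C"
proof (rule LIMSEQ_le_const[OF prob_sieve_event_limit], intro exI allI impI)
  fix N
  let ?K = "C \<inter> {..N}" and ?eC = "(\<lambda>c. e * c) ` C"
  have K: "finite ?K" "?K \<subseteq> {1..}" using C by auto
  have eK: "finite ((\<lambda>c. e * c) ` ?K)" "(\<lambda>c. e * c) ` ?K \<subseteq> {1..}" using K e by (auto simp: Suc_le_eq)
  have "profinite.prob (sieve_event e 0 {0} ?eC) \<le> profinite.prob (sieve_event e 0 {0} ((\<lambda>c. e * c) ` ?K))"
    by (intro profinite.finite_measure_mono sieve_event_antimono sets_sieve_event) auto
  also have "\<dots> \<le> density_free ?K"
  proof -
    define q where "q = \<Prod>?K"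
    have q: "q > 0" "\<And>c. c \<in> ?K \<Longrightarrow> c dvd q"
      using K by (auto simp: q_def Suc_le_eq intro!: prod_pos dvd_prodI)
    let ?S = "sieve_set e 0 {0} ((\<lambda>c. e * c) ` ?K)"
    have "card (?S \<inter> {0..<int (e * q)}) \<le> card (free_integers ?K \<inter> {0..<int q})"
    proof (rule card_inj_on_le)
      show "inj_on (\<lambda>n. n div int e) (?S \<inter> {0..<int (e * q)})"
        using e by (auto simp: inj_on_def sieve_set_def elim!: dvdE dest!: mod_0_imp_dvd)
      show "(\<lambda>n. n div int e) ` (?S \<inter> {0..<int (e * q)}) \<subseteq> free_integers ?K \<inter> {0..<int q}"
      proof
        fix m assume "m \<in> (\<lambda>n. n div int e) ` (?S \<inter> {0..<int (e * q)})"
        then have "int e * m \<in> ?S" "int e * m \<in> {0..<int (e * q)}"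
          using e by (auto simp: sieve_set_def elim!: dvdE dest!: mod_0_imp_dvd)
        then show "m \<in> free_integers ?K \<inter> {0..<int q}"
          using e by (auto simp: sieve_set_def in_free_integers zero_le_mult_iff)
      qed
    qed simp
    then have "card (?S \<inter> {0..<int (e * q)}) / (e * q) \<le> card (free_integers ?K \<inter> {0..<int q}) / (1 * q)"
      using e q(1) by (intro frac_le) (auto simp: Suc_le_eq)
    moreover have "profinite.prob (sieve_event e 0 {0} ((\<lambda>c. e * c) ` ?K)) = card (?S \<inter> {0..<int (e * q)}) / (e * q)"
    proof -
      have "b dvd e * q" if "b \<in> (\<lambda>c. e * c) ` ?K" for b using that q(2) by auto
      then show ?thesis
        using sieve_event_finite[of "(\<lambda>c. e * c) ` ?K" "e * q" e 0 "{0}"] prob_residue[of "e * q" ?S] q e by simp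
    qed
    moreover have "density_free ?K = card (free_integers ?K \<inter> {0..<int q}) / q"
      using sieve_event_finite[of ?K q 1 0 "{0}", unfolded sieve_set_1] prob_residue[OF q(1), of "free_integers ?K"] q
      by auto
    ultimately show ?thesis by simp
  qed
  finally show "profinite.prob (sieve_event e 0 {0} ?eC) \<le> density_free ?K" .
qed

text \<open>A set \<open>C\<close> with \<open>1 \<notin> C\<close> and \<open>density_free C = 0\<close> is called a Behrend set. It remains one after removal of an
element \<open>c\<close>, by correlation with the single condition \<open>c\<close>, which is satisfied with positive probability. Then
\<open>e c\<close> is not essential in \<open>B\<close>, because almost every multiple of \<open>e\<close> is already a multiple of another element of \<open>e C\<close>.\<close>

lemma taut_no_scaled_behrend:
  assumes "taut B" and B: "B \<subseteq> {1..}" and e: "e > 0" and "1 \<notin> C" and sub: "(\<lambda>c. e * c) ` C \<subseteq> B"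
  shows "density_free C > 0"
proof (rule ccontr)
  assume "\<not> density_free C > 0"
  then have C0: "density_free C = 0" by (simp add: not_less measure_le_0_iff)
  have C: "C \<subseteq> {1..}" using sub B by (force simp: Suc_le_eq)
  have "C \<noteq> {}" using C0 density_free_empty by (metis zero_neq_one)
  then obtain c where c: "c \<in> C" by blast
  have "c > 1" using c C \<open>1 \<notin> C\<close> by (cases "c = 1") (auto simp: Suc_le_eq subset_iff)
  have "density_free (C - {c}) * density_free {c} \<le> density_free (C - {c} \<union> {c})"
    using C c by (intro density_free_correlation) auto
  also have "C - {c} \<union> {c} = C" using c by auto
  finally have "density_free (C - {c}) = 0"
    using density_free_singleton_pos[OF \<open>c > 1\<close>] C0
    by (smt (verit) measure_nonneg mult_pos_pos)
  then have 0: "profinite.prob (sieve_event e 0 {0} ((\<lambda>c. e * c) ` (C - {c}))) \<le> 0"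
    using sieve_event_scaled_le[of "C - {c}" e] C e by auto
  have "sieve_event (e * c) 0 {0} (B - {e * c}) \<subseteq> sieve_event e 0 {0} ((\<lambda>c. e * c) ` (C - {c}))"
  proof -
    have image: "(\<lambda>c. e * c) ` (C - {c}) \<subseteq> B - {e * c}" using sub e by auto
    have "residue e \<omega> = 0" if "residue (e * c) \<omega> = 0" for \<omega>
      using residue_mod[of e "e * c" \<omega>] that e \<open>c > 1\<close> by simp
    then have "sieve_event (e * c) 0 {0} (B - {e * c}) \<subseteq> sieve_event e 0 {0} (B - {e * c})"
      by (auto simp: sieve_event_def)
    also have "\<dots> \<subseteq> sieve_event e 0 {0} ((\<lambda>c. e * c) ` (C - {c}))"
      by (rule sieve_event_antimono[OF image])
    finally show ?thesis .
  qed
  then have "profinite.prob (sieve_event (e * c) 0 {0} (B - {e * c})) \<le> 0"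
    using profinite.finite_measure_mono[OF _ sets_sieve_event] 0 by (meson order_trans)
  moreover have "profinite.prob (sieve_event (e * c) 0 {0} (B - {e * c})) > 0"
    using sub c by (intro taut_imp_essential assms) auto
  ultimately show False by simp
qed

text \<open>Put \<open>d = gcd a r\<close> and sort the quotients \<open>b / gcd b d\<close> by the value \<open>e = gcd b d\<close> into sets \<open>C\<^sub>e\<close>, keeping
those that are coprime to \<open>a / d\<close>. Their union has \<open>density_free\<close> equal to \<open>0\<close> by \<open>density_free_quotient_le\<close>, so one of the
finitely many \<open>C\<^sub>e\<close> does. Since \<open>B\<close> contains no scaled Behrend set, \<open>1 \<in> C\<^sub>e\<close>, that is \<open>e \<in> B\<close>; and \<open>e\<close> divides \<open>a\<close>.\<close>

lemma taut_covered_class: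
  assumes "taut B" and B: "B \<subseteq> {1..}" and a: "a > 0"
    and null: "profinite.prob (sieve_event a r {0} B) = 0"
  shows "\<exists>b\<in>B. b dvd a"
proof -
  define d where "d = nat (gcd (int a) r)"
  have d: "d > 0" "d dvd a" "int d dvd r"
    using a by (auto simp: d_def nat_dvd_iff)
  define a' where "a' = a div d"
  define r' where "r' = r div int d"
  have eq: "a = d * a'" "r = int d * r'" using d by (auto simp: a'_def r'_def)
  have a': "a' > 0" using a eq by (cases "a' = 0") auto
  have cop: "coprime r' (int a')"
  proof -
    have "coprime (int a div gcd (int a) r) (r div gcd (int a) r)"
      using a by (intro div_gcd_coprime) auto
    then show ?thesis
      by (simp add: a'_def r'_def d_def coprime_commute zdiv_int)
  qed
  define C where "C e = {c. e * c \<in> B \<and> gcd (e * c) d = e \<and> coprime c a'}" for e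
  have C1: "C e \<subseteq> {1..}" for e using B by (auto simp: C_def Suc_le_eq subset_iff intro!: gr0I)
  have "density_free (\<Union>e\<in>{e. e dvd d}. C e) \<le> 0"
  proof (rule LIMSEQ_le_const)
    have "(\<lambda>N. real a * profinite.prob (sieve_event a r {0} (B \<inter> {..N}))) \<longlonglongrightarrow> real a * 0"
      using prob_sieve_event_limit[of a r "{0}" B] null by (intro tendsto_intros) simp
    then show "(\<lambda>N. a * profinite.prob (sieve_event a r {0} (B \<inter> {..N}))) \<longlonglongrightarrow> 0" by simp
    show "\<exists>N. \<forall>n\<ge>N. density_free (\<Union>e\<in>{e. e dvd d}. C e) \<le> a * profinite.prob (sieve_event a r {0} (B \<inter> {..n}))"
    proof (intro exI allI impI)
      fix N
      let ?D = "{c. \<exists>b\<in>B \<inter> {..N}. c = b div gcd b d \<and> coprime c a'}"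
      have "?D \<subseteq> (\<Union>e\<in>{e. e dvd d}. C e)"
      proof
        fix c assume "c \<in> ?D"
        then obtain b where b: "b \<in> B" "c = b div gcd b d" "coprime c a'" by auto
        then have "gcd b d * c = b" by simp
        then have "c \<in> C (gcd b d)" using b(1,3) by (simp add: C_def)
        then show "c \<in> (\<Union>e\<in>{e. e dvd d}. C e)" by auto
      qed
      then have "density_free (\<Union>e\<in>{e. e dvd d}. C e) \<le> density_free ?D"
        by (intro profinite.finite_measure_mono sieve_event_antimono sets_sieve_event)
      also have "\<dots> \<le> real (d * a') * profinite.prob (sieve_event (d * a') (int d * r') {0} (B \<inter> {..N}))"
        using B by (intro density_free_quotient_le d a' cop) auto
      finally show "density_free (\<Union>e\<in>{e. e dvd d}. C e) \<le> a * profinite.prob (sieve_event a r {0} (B \<inter> {..N}))"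
        using eq by simp
    qed
  qed
  then have "density_free (\<Union>e\<in>{e. e dvd d}. C e) = 0"
    by (simp add: measure_le_0_iff)
  then obtain e where e: "e dvd d" "density_free (C e) = 0"
    using density_free_UN_zero[of "{e. e dvd d}" C] d C1 by auto
  have "1 \<in> C e"
  proof (rule ccontr)
    assume "1 \<notin> C e"
    then have "density_free (C e) > 0"
      using e(1) d(1) by (intro taut_no_scaled_behrend[OF assms(1,2), of e]) (auto simp: C_def intro: gr0I)
    then show False using e(2) by simp
  qed
  then have "e \<in> B" by (simp add: C_def)
  then show ?thesis using e(1) d(2) by (meson dvd_trans)
qed

section \<open>Translations of the random profinite integer\<close>

text \<open>Over a full period \<open>q\<close>, every residue falls into \<open>S\<close> for the same number of translations, whatever
the event \<open>A\<close> is.\<close>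

lemma sum_shift_prob:
  assumes per: "periodic q S" and q: "q > 0" and A: "A \<in> sets profinite"
  shows "(\<Sum>k<q. profinite.prob (A \<inter> {\<omega>. residue q \<omega> + int k \<in> S}))
       = real q * profinite.prob A * profinite.prob {\<omega>. residue q \<omega> \<in> S}"
proof -
  have meas: "A \<inter> {\<omega>. residue q \<omega> + int k \<in> S} \<in> sets profinite" for k
    using A sets_residue[of "\<lambda>x. x + int k \<in> S" q] by auto
  have int: "integrable profinite (indicator (A \<inter> {\<omega>. residue q \<omega> + int k \<in> S}) :: _ \<Rightarrow> real)" for k
    using meas by (intro integrable_real_indicator) (auto simp: profinite.emeasure_eq_measure)
  have "(\<Sum>k<q. profinite.prob (A \<inter> {\<omega>. residue q \<omega> + int k \<in> S}))
      = (\<Sum>k<q. \<integral>\<omega>. indicator (A \<inter> {\<omega>. residue q \<omega> + int k \<in> S}) \<omega> \<partial>profinite)"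
    using meas by simp
  also have "\<dots> = (\<integral>\<omega>. (\<Sum>k<q. indicator (A \<inter> {\<omega>. residue q \<omega> + int k \<in> S}) \<omega>) \<partial>profinite)"
    using int by (intro Bochner_Integration.integral_sum[symmetric])
  also have "\<dots> = (\<integral>\<omega>. real (card (S \<inter> {0..<int q})) * indicator A \<omega> \<partial>profinite)"
  proof (intro Bochner_Integration.integral_cong refl)
    fix \<omega>
    have "(\<Sum>k<q. indicator (A \<inter> {\<omega>. residue q \<omega> + int k \<in> S}) \<omega>)
        = indicator A \<omega> * (\<Sum>k<q. of_bool (residue q \<omega> + int k \<in> S) :: real)"
      unfolding sum_distrib_left by (intro sum.cong) (auto simp: indicator_def)
    then show "(\<Sum>k<q. indicator (A \<inter> {\<omega>. residue q \<omega> + int k \<in> S}) \<omega>)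
        = real (card (S \<inter> {0..<int q})) * (indicator A \<omega> :: real)"
      using sum_periodic[OF per q] by (simp add: mult.commute)
  qed
  also have "\<dots> = card (S \<inter> {0..<int q}) * profinite.prob A"
    using A by simp
  finally show ?thesis using prob_residue[OF q, of S] q by simp
qed

lemma card_periodic_shift:
  assumes "periodic q S" "q > 0"
  shows "card ({n. n + k \<in> S} \<inter> {0..<int q}) = card (S \<inter> {0..<int q})"
proof -
  have "periodic q {n. n + k \<in> S}"
    using assms(1) unfolding periodic_def mem_Collect_eq by (metis add.assoc add.commute)
  from sum_periodic[OF this assms(2), of 0] sum_periodic[OF assms, of k]
  show ?thesis by (simp add: add.commute)
qed

lemma prob_residue_shift:
  assumes "periodic q S" "q > 0"
  shows "profinite.prob {\<omega>. residue q \<omega> + k \<in> S} = profinite.prob {\<omega>. residue q \<omega> \<in> S}"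
  using prob_residue[OF assms(2), of "{n. n + k \<in> S}"] prob_residue[OF assms(2), of S]
    card_periodic_shift[OF assms] by simp

lemma common_period:
  fixes K :: "nat set"
  assumes "finite K" "K \<subseteq> {1..}" "a > 0"
  obtains q where "q > 0" "a dvd q" "\<And>b. b \<in> K \<Longrightarrow> b dvd q"
proof
  show "a * \<Prod>K > 0" using assms by (auto intro!: prod_pos)
  show "b dvd a * \<Prod>K" if "b \<in> K" for b using assms(1) that by (intro dvd_mult dvd_prodI)
qed simp

lemma mod_diff_shift_iff: "(n + k) mod a = r mod a \<longleftrightarrow> n mod a = (r - k) mod a" for n k r a :: int
  unfolding cong_def[symmetric] cong_iff_dvd_diff by (simp add: algebra_simps)

lemma sieve_event_shift_finite:
  assumes "\<And>b. b \<in> K \<Longrightarrow> b dvd q" "a dvd q" "q > 0"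
  shows "sieve_event a (r - k) ((\<lambda>i. i + k) ` I) K = {\<omega>. residue q \<omega> + k \<in> sieve_set a r I K}"
proof -
  have "sieve_event a (r - k) ((\<lambda>i. i + k) ` I) K = {\<omega>. residue q \<omega> \<in> sieve_set a (r - k) ((\<lambda>i. i + k) ` I) K}"
    by (rule sieve_event_finite) (use assms in auto)
  then show ?thesis
    by (simp add: sieve_set_def mod_diff_shift_iff add.assoc add.commute[of k])
qed

lemma prob_sieve_event_shift:
  assumes B: "B \<subseteq> {1..}" and a: "a > 0"
  shows "profinite.prob (sieve_event a (r - k) ((\<lambda>i. i + k) ` I) B) = profinite.prob (sieve_event a r I B)"
proof -
  have "profinite.prob (sieve_event a (r - k) ((\<lambda>i. i + k) ` I) (B \<inter> {..N}))
      = profinite.prob (sieve_event a r I (B \<inter> {..N}))" for N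
  proof -
    have "finite (B \<inter> {..N})" "B \<inter> {..N} \<subseteq> {1..}" using B by auto
    from common_period[OF this a]
    obtain q where q: "q > 0" "a dvd q" "\<And>b. b \<in> B \<inter> {..N} \<Longrightarrow> b dvd q" by blast
    have "sieve_event a (r - k) ((\<lambda>i. i + k) ` I) (B \<inter> {..N})
        = {\<omega>. residue q \<omega> + k \<in> sieve_set a r I (B \<inter> {..N})}"
      by (rule sieve_event_shift_finite) (use q in auto)
    moreover have "sieve_event a r I (B \<inter> {..N}) = {\<omega>. residue q \<omega> \<in> sieve_set a r I (B \<inter> {..N})}"
      by (rule sieve_event_finite) (use q in auto)
    ultimately show ?thesis
      using prob_residue_shift[OF periodic_sieve_set[of "B \<inter> {..N}" q a r I] q(1), of k] q(2,3) by simp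
  qed
  then have "(\<lambda>N. profinite.prob (sieve_event a r I (B \<inter> {..N})))
      \<longlonglongrightarrow> profinite.prob (sieve_event a (r - k) ((\<lambda>i. i + k) ` I) B)"
    using prob_sieve_event_limit[of a "r - k" "(\<lambda>i. i + k) ` I" B] by simp
  then show ?thesis using prob_sieve_event_limit by (rule LIMSEQ_unique)
qed

text \<open>The translations of the sieve event equidistribute with respect to any event \<open>A\<close>, so a positive probability for both
would force them to meet. For a truncation \<open>K\<close> the average over translations is exactly the product
of the probabilities, and replacing \<open>B\<close> by \<open>K\<close> costs the same small amount for every translation.\<close>

lemma sieve_ergodic:
  assumes B: "B \<subseteq> {1..}" and a: "a > 0" and A: "A \<in> sets profinite"
    and disj: "\<And>k. A \<inter> sieve_event a (r - k) {k} B = {}"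
  shows "profinite.prob A * profinite.prob (sieve_event a r {0} B) = 0"
proof -
  let ?D = "\<lambda>B. profinite.prob (sieve_event a r {0} B)"
  have "profinite.prob A * ?D (B \<inter> {..N}) \<le> ?D (B \<inter> {..N}) - ?D B" for N
  proof -
    define K where "K = B \<inter> {..N}"
    have "finite K" "K \<subseteq> {1..}" using B by (auto simp: K_def)
    from common_period[OF this a]
    obtain q where q: "q > 0" "a dvd q" "\<And>b. b \<in> K \<Longrightarrow> b dvd q" by blast
    let ?S = "sieve_set a r {0} K"
    have DK: "?D K = profinite.prob {\<omega>. residue q \<omega> \<in> ?S}"
      by (rule arg_cong[where f = profinite.prob], rule sieve_event_finite) (use q in auto)
    have shift: "sieve_event a (r - k) {k} K = {\<omega>. residue q \<omega> + k \<in> ?S}" for k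
      using sieve_event_shift_finite[of K q a r k "{0}"] q by simp
    have le: "profinite.prob (A \<inter> {\<omega>. residue q \<omega> + k \<in> ?S}) \<le> ?D K - ?D B" for k
    proof -
      have sub: "sieve_event a (r - k) {k} B \<subseteq> sieve_event a (r - k) {k} K"
        by (rule sieve_event_antimono) (simp add: K_def)
      have "profinite.prob (A \<inter> {\<omega>. residue q \<omega> + k \<in> ?S})
          \<le> profinite.prob (sieve_event a (r - k) {k} K - sieve_event a (r - k) {k} B)"
        unfolding shift[symmetric] using disj[of k] by (intro profinite.finite_measure_mono) auto
      also have "\<dots> = profinite.prob (sieve_event a (r - k) {k} K) - profinite.prob (sieve_event a (r - k) {k} B)"
        using sub by (intro profinite.finite_measure_Diff) auto
      also have "\<dots> = ?D K - ?D B"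
        using prob_sieve_event_shift[OF B a, of r k "{0}"]
          prob_sieve_event_shift[OF \<open>K \<subseteq> {1..}\<close> a, of r k "{0}"] by simp
      finally show ?thesis .
    qed
    have "real q * (profinite.prob A * ?D K) = (\<Sum>k<q. profinite.prob (A \<inter> {\<omega>. residue q \<omega> + int k \<in> ?S}))"
      unfolding DK using sum_shift_prob[OF periodic_sieve_set[of K q a r "{0}"] q(1) A] q(2,3) by simp
    also have "\<dots> \<le> (\<Sum>k<q. ?D K - ?D B)" by (intro sum_mono le)
    also have "\<dots> = real q * (?D K - ?D B)" by simp
    finally show ?thesis using q(1) by (simp add: K_def)
  qed
  then have "profinite.prob A * ?D B \<le> ?D B - ?D B"
    by (intro LIMSEQ_le[OF tendsto_mult[OF tendsto_const prob_sieve_event_limit]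
          tendsto_diff[OF prob_sieve_event_limit tendsto_const]]) auto
  moreover have "0 \<le> profinite.prob A * ?D B" by simp
  ultimately show ?thesis by linarith
qed

section \<open>Admissible sequences and hereditary closures\<close>

lemma closed_coordinate: "closed {x :: biseq. x n = c}"
proof -
  have "closed ((\<lambda>x :: biseq. x n) -` {c})"
    by (intro closed_vimage) (auto simp: discrete_topology_class.open_discrete closed_def)
  then show ?thesis by (simp add: vimage_def)
qed

lemma closed_agreeing_windows:
  fixes X :: "biseq set"
  assumes "closed X" and approx: "\<And>N::nat. \<exists>y\<in>X. \<forall>i\<in>{- int N..int N}. y i = x i"
  shows "x \<in> X"
proof (rule ccontr)
  assume "x \<notin> X"
  have op: "openin (product_topology (\<lambda>_::int. euclidean :: bool topology) UNIV) (- X)"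
    using assms(1) by (simp add: closed_def open_fun_def)
  then obtain U where U: "finite {i. U i \<noteq> UNIV}" "x \<in> Pi\<^sub>E UNIV U" "Pi\<^sub>E UNIV U \<subseteq> - X"
  proof -
    obtain V where V: "finite {i \<in> UNIV. V i \<noteq> topspace (euclidean :: bool topology)}"
      "x \<in> Pi\<^sub>E UNIV V" "Pi\<^sub>E UNIV V \<subseteq> - X"
      using \<open>x \<notin> X\<close> op unfolding openin_product_topology_alt Compl_iff[symmetric] by meson
    then show thesis using that[of V] by simp
  qed
  define N where "N = nat (Max (insert 0 (abs ` {i. U i \<noteq> UNIV})))"
  have N: "i \<in> {- int N..int N}" if "U i \<noteq> UNIV" for i
  proof -
    have "\<bar>i\<bar> \<le> Max (insert 0 (abs ` {i. U i \<noteq> UNIV}))"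
      using U(1) that by (intro Max_ge) auto
    then show ?thesis by (auto simp: N_def)
  qed
  obtain y where y: "y \<in> X" "\<forall>i\<in>{- int N..int N}. y i = x i" using approx by blast
  have "y i \<in> U i" for i
    using U(2) N[of i] y(2) by (cases "U i = UNIV") (auto simp: PiE_iff)
  then have "y \<in> Pi\<^sub>E UNIV U" by auto
  then show False using U(3) y(1) by auto
qed

lemma admissible_iff:
  assumes "B \<subseteq> {1..}"
  shows "x \<in> admissible B \<longleftrightarrow> (\<forall>b\<in>B. \<exists>r\<in>{0..<int b}. \<forall>n. n mod int b = r \<longrightarrow> \<not> x n)"
proof -
  have "card ((\<lambda>n. n mod int b) ` supp x) < b \<longleftrightarrow> (\<exists>r\<in>{0..<int b}. \<forall>n. n mod int b = r \<longrightarrow> \<not> x n)"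
    if "b \<in> B" for b
  proof -
    let ?I = "(\<lambda>n. n mod int b) ` supp x"
    have sub: "?I \<subseteq> {0..<int b}" using that assms by (auto simp: Suc_le_eq)
    have "card ?I < b \<longleftrightarrow> ?I \<noteq> {0..<int b}"
      using sub card_mono[OF _ sub] card_subset_eq[OF _ sub] by fastforce
    also have "\<dots> \<longleftrightarrow> (\<exists>r\<in>{0..<int b}. r \<notin> ?I)" using sub by blast
    also have "\<dots> \<longleftrightarrow> (\<exists>r\<in>{0..<int b}. \<forall>n. n mod int b = r \<longrightarrow> \<not> x n)"
      by (intro bex_cong refl) (auto simp: supp_def)
    finally show ?thesis .
  qed
  then show ?thesis by (simp add: admissible_def)
qed

lemma closed_admissible:
  assumes "B \<subseteq> {1..}"
  shows "closed (admissible B)"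
proof -
  have "admissible B = (\<Inter>b\<in>B. \<Union>r\<in>{0..<int b}. \<Inter>n\<in>{n. n mod int b = r}. {x. x n = False})"
  proof (rule Set.set_eqI)
    fix x
    show "x \<in> admissible B \<longleftrightarrow>
        x \<in> (\<Inter>b\<in>B. \<Union>r\<in>{0..<int b}. \<Inter>n\<in>{n. n mod int b = r}. {x. x n = False})"
      unfolding admissible_iff[OF assms] by (simp only: INT_iff UN_iff mem_Collect_eq Ball_def Bex_def simp_thms)
  qed
  then show ?thesis
    by (simp only:) (intro closed_INT closed_UN ballI closed_coordinate finite_atLeastLessThan_int)
qed

lemma admissible_shift:
  assumes "B \<subseteq> {1..}" "x \<in> admissible B"
  shows "shift_by m x \<in> admissible B"
  unfolding admissible_iff[OF assms(1)]
proof
  fix b assume b: "b \<in> B"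
  then obtain r where r0: "r \<in> {0..<int b}" and r: "\<forall>n. n mod int b = r \<longrightarrow> \<not> x n"
    using assms(2) by (auto simp: admissible_iff[OF assms(1)])
  have "b > 0" using b assms(1) by auto
  show "\<exists>r\<in>{0..<int b}. \<forall>n. n mod int b = r \<longrightarrow> \<not> shift_by m x n"
  proof (intro bexI[of _ "(r - m) mod int b"] allI impI)
    fix n assume "n mod int b = (r - m) mod int b"
    then have "(n + m) mod int b = r mod int b" by (simp add: mod_diff_shift_iff)
    moreover have "r mod int b = r" using r0 by simp
    ultimately show "\<not> shift_by m x n" using r by (simp add: shift_by_def)
  qed (use \<open>b > 0\<close> in simp)
qed

lemma subshift_admissible:
  assumes "B \<subseteq> {1..}"
  shows "subshift (admissible B)"
  unfolding subshift_def
proof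
  show "shift ` admissible B = admissible B"
  proof
    show "shift ` admissible B \<subseteq> admissible B" using admissible_shift[OF assms] by auto
    show "admissible B \<subseteq> shift ` admissible B"
    proof
      fix x assume "x \<in> admissible B"
      then have "shift_by (-1) x \<in> admissible B" by (rule admissible_shift[OF assms])
      then show "x \<in> shift ` admissible B"
        by (rule rev_image_eqI) (simp add: shift_by_add shift_by_0)
    qed
  qed
qed (rule closed_admissible[OF assms])

lemma hereditary_admissible:
  assumes "B \<subseteq> {1..}"
  shows "hereditary (admissible B)"
  unfolding hereditary_def
proof (intro ballI allI impI)
  fix x y assume "x \<in> admissible B" "y \<le> x"
  then show "y \<in> admissible B"
    unfolding admissible_iff[OF assms] le_fun_def le_bool_def by meson
qed

lemma eta_admissible:
  assumes "B \<subseteq> {1..}"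
  shows "eta B \<in> admissible B"
  unfolding admissible_iff[OF assms]
proof
  fix b assume "b \<in> B"
  moreover from this have "b > 0" using assms by auto
  ultimately show "\<exists>r\<in>{0..<int b}. \<forall>n. n mod int b = r \<longrightarrow> \<not> eta B n"
    by (intro bexI[of _ 0]) (auto simp: eta_def in_free_integers dest: mod_0_imp_dvd)
qed

lemma shift_eta_in_X_eta: "shift_by m (eta B) \<in> X_eta B"
  unfolding X_eta_def by (rule closure_subset[THEN subsetD]) (rule rangeI)

lemma X_eta_hereditary_subset_admissible:
  assumes "B \<subseteq> {1..}"
  shows "X_eta_hereditary B \<subseteq> admissible B"
proof (rule hereditary_hull_smallest(4))
  show "X_eta B \<subseteq> admissible B"
    unfolding X_eta_def
    using admissible_shift[OF assms eta_admissible[OF assms]] closed_admissible[OF assms]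
    by (intro closure_minimal) auto
qed (intro subshift_admissible hereditary_admissible assms)+

text \<open>A residue class modulo \<open>b'\<close> that contains no \<open>B\<close>-free integer is, by the transfer principle, also covered for the random
profinite integer.\<close>

lemma taut_eta_admissible:
  assumes "taut B" "B \<subseteq> {1..}" "B' \<subseteq> {1..}" "eta B \<in> admissible B'" "b' \<in> B'"
  shows "\<exists>b\<in>B. b dvd b'"
proof -
  obtain r where r: "r \<in> {0..<int b'}" "\<forall>n. n mod int b' = r \<longrightarrow> \<not> eta B n"
    using assms(4,5) by (auto simp: admissible_iff[OF assms(3)])
  have b': "b' > 0" using assms(3,5) by auto
  have "sieve_set b' r (int ` {0}) B = {}"
    using r by (auto simp: sieve_set_def eta_def)
  then have "\<not> profinite.prob (sieve_event b' r (int ` {0}) B) > 0"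
    using sieve_transfer[OF assms(2) b', of "{0}" r] by auto
  then have "profinite.prob (sieve_event b' r {0} B) = 0"
    by (simp add: not_less measure_le_0_iff)
  then show ?thesis by (rule taut_covered_class[OF assms(1,2) b'])
qed

text \<open>Almost surely, every finite set of positions at which \<open>sieve B \<omega>\<close> is true is one that occurs with positive probability, there being only
countably many finite sets. The transfer principle finds the same positions in some translate of \<open>eta B\<close>, and
heredity erases the superfluous ones.\<close>

lemma AE_sieve_in_hull:
  assumes B: "B \<subseteq> {1..}"
  shows "AE \<omega> in profinite. sieve B \<omega> \<in> X_eta_hereditary B"
proof -
  have "AE \<omega> in profinite. \<omega> \<in> sieve_event 1 0 I B \<longrightarrow> profinite.prob (sieve_event 1 0 I B) > 0" for I
  proof (cases "profinite.prob (sieve_event 1 0 I B) > 0")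
    case False
    then have "profinite.prob (sieve_event 1 0 I B) = 0" by (simp add: not_less measure_le_0_iff)
    then have "AE \<omega> in profinite. \<omega> \<notin> sieve_event 1 0 I B"
      by (simp add: profinite.prob_eq_0)
    then show ?thesis by eventually_elim simp
  qed simp
  then have "AE \<omega> in profinite. \<forall>I\<in>{I. finite I}. \<omega> \<in> sieve_event 1 0 I B \<longrightarrow>
      profinite.prob (sieve_event 1 0 I B) > 0"
    by (subst AE_ball_countable[OF countable_Collect_finite]) blast
  then show ?thesis
  proof eventually_elim
    case (elim \<omega>)
    show ?case
    proof (rule closed_agreeing_windows)
      show "closed (X_eta_hereditary B)"
        using hereditary_hull_smallest(1) by (auto simp: subshift_def)
      fix N :: nat
      define I where "I = {i\<in>{- int N..int N}. sieve B \<omega> i}"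
      have I: "finite I"
        by (rule finite_subset[of _ "{- int N..int N}"]) (auto simp: I_def)
      have "\<omega> \<in> sieve_event 1 0 I B"
        by (auto simp: sieve_event_def I_def residue_def)
      then have pos: "profinite.prob (sieve_event 1 0 I B) > 0" using elim I by blast
      \<comment> \<open>Translated by \<open>N\<close>, the window consists of natural numbers, as the transfer principle requires.\<close>
      define J where "J = (\<lambda>i. nat (i + int N)) ` I"
      have J: "int ` J = (\<lambda>i. i + int N) ` I"
        by (force simp: J_def I_def image_image)
      have "profinite.prob (sieve_event 1 (0 - int N) (int ` J) B) > 0"
        unfolding J using prob_sieve_event_shift[OF B, of 1 0 "int N" I] pos by simp
      then obtain m where m: "m \<in> sieve_set 1 (0 - int N) (int ` J) B"
        using sieve_transfer[OF B, of 1 J "0 - int N"] I by (auto simp: J_def)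
      have "i \<in> I \<Longrightarrow> shift_by (m + int N) (eta B) i" for i
        using m unfolding J by (auto simp: sieve_set_def shift_by_def eta_def algebra_simps)
      then have "(\<lambda>i. i \<in> I) \<le> shift_by (m + int N) (eta B)" by (simp add: le_fun_def)
      moreover have "shift_by (m + int N) (eta B) \<in> X_eta_hereditary B"
        using shift_eta_in_X_eta hereditary_hull_smallest(3) by blast
      ultimately have "(\<lambda>i. i \<in> I) \<in> X_eta_hereditary B"
        using hereditary_hull_smallest(2) by (auto simp: hereditary_def)
      then show "\<exists>y\<in>X_eta_hereditary B. \<forall>i\<in>{- int N..int N}. y i = sieve B \<omega> i"
        by (rule bexI[rotated]) (auto simp: I_def)
    qed
  qed
qed

text \<open>Some pair of residues \<open>r\<close> and \<open>m\<close> occurs with positive probability as a class missed by \<open>sieve B \<omega>\<close> and as the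
residue of \<open>\<omega>\<close>. By ergodicity, the class of \<open>m + r\<close> cannot contain \<open>B\<close>-free profinite integers with positive probability.\<close>

lemma taut_AE_sieve_admissible:
  assumes "taut B" "B \<subseteq> {1..}" "B' \<subseteq> {1..}"
    and AE: "AE \<omega> in profinite. sieve B \<omega> \<in> admissible B'" and "b' \<in> B'"
  shows "\<exists>b\<in>B. b dvd b'"
proof -
  define a where "a = b'"
  have a: "a > 0" using assms(3,5) by (auto simp: a_def)
  \<comment> \<open>The residue of \<open>\<omega>\<close> is recorded as well, because the missed class is relative to \<open>\<omega>\<close>.\<close>
  define A where "A r m = {\<omega>. (\<forall>n\<in>{n. n mod int a = r}. \<not> sieve B \<omega> n) \<and> residue a \<omega> = m}" for r m
  have A: "A r m \<in> sets profinite" for r m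
  proof -
    have "countable {n. n mod int a = r}" by simp
    then have "Measurable.pred profinite (\<lambda>\<omega>. (\<forall>n\<in>{n. n mod int a = r}. \<not> sieve B \<omega> n) \<and> residue a \<omega> = m)"
      by measurable
    then show ?thesis by (simp add: A_def pred_def)
  qed
  have "\<exists>r\<in>{0..<int a}. \<exists>m. profinite.prob (A r m) \<noteq> 0"
  proof (rule ccontr)
    assume "\<not> ?thesis"
    then have "AE \<omega> in profinite. r \<in> {0..<int a} \<longrightarrow> \<omega> \<notin> A r m" for r m
      using A by (cases "r \<in> {0..<int a}") (simp_all add: profinite.prob_eq_0)
    then have "AE \<omega> in profinite. \<forall>r m. r \<in> {0..<int a} \<longrightarrow> \<omega> \<notin> A r m" by (simp add: AE_all_countable)
    with AE have "AE \<omega> in profinite. False"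
    proof eventually_elim
      case (elim \<omega>)
      then obtain r where "r \<in> {0..<int a}" "\<forall>n. n mod int a = r \<longrightarrow> \<not> sieve B \<omega> n"
        using assms(5) by (auto simp: admissible_iff[OF assms(3)] a_def)
      moreover from this have "\<omega> \<in> A r (residue a \<omega>)" by (simp add: A_def)
      ultimately show ?case using elim by blast
    qed
    then show False using profinite.AE_False by blast
  qed
  then obtain r m where r: "r \<in> {0..<int a}" and rm: "profinite.prob (A r m) \<noteq> 0" by blast
  have "A r m \<inter> sieve_event a (m + r - k) {k} B = {}" for k
  proof (rule ccontr)
    assume "A r m \<inter> sieve_event a (m + r - k) {k} B \<noteq> {}"
    then obtain \<omega> where "\<omega> \<in> A r m" "\<omega> \<in> sieve_event a (m + r - k) {k} B" by blast
    then have w: "\<forall>n. n mod int a = r \<longrightarrow> \<not> sieve B \<omega> n" "residue a \<omega> = m"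
       "residue a \<omega> = (m + r - k) mod int a" "sieve B \<omega> k"
      by (simp_all add: A_def sieve_event_def)
    have "m mod int a = m"
      using w(2) residue_bounds[OF a, of \<omega>] by simp
    then have "m mod int a = (m + r - k) mod int a" using w(2,3) by simp
    then have "int a dvd k - r" unfolding mod_eq_dvd_iff by (simp add: algebra_simps)
    then have "k mod int a = r mod int a" unfolding mod_eq_dvd_iff .
    then have "k mod int a = r" using r by simp
    then show False using w(1,4) by blast
  qed
  from sieve_ergodic[OF assms(2) a A this] rm
  have "profinite.prob (sieve_event a (m + r) {0} B) = 0" by simp
  then show ?thesis unfolding a_def by (intro taut_covered_class assms a[unfolded a_def])
qed

text \<open>With a countable base for \<open>bool\<close>, the Borel sets of \<open>int \<Rightarrow> bool\<close> are generated by the coordinates.\<close>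

instance bool :: second_countable_topology
proof
  show "\<exists>B :: bool set set. countable B \<and> open = generate_topology B"
  proof (intro exI conjI ext iffI)
    show "countable (UNIV :: bool set set)" by simp
    show "generate_topology UNIV A" for A :: "bool set" by (rule generate_topology.Basis) simp
  qed (rule discrete_topology_class.open_discrete)
qed

lemma borel_measurable_biseq:
  assumes "\<And>n. Measurable.pred M (\<lambda>x. f x n)"
  shows "(f :: 'a \<Rightarrow> biseq) \<in> borel_measurable M"
proof (rule measurable_coordinatewise_then_product)
  fix n show "(\<lambda>x. f x n) \<in> borel_measurable M"
    using assms[of n] measurable_cong_sets[OF refl sets_borel_eq_count_space] by blast
qed

lemma sets_borel_biseq:
  "sets (borel :: biseq measure) = sigma_sets UNIV ((\<lambda>I. {x. \<forall>i\<in>I. x i}) ` {I. finite I})"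
    (is "_ = sigma_sets UNIV ?E")
proof
  have borel: "sets (borel :: biseq measure) = sigma_sets UNIV {{f. f i \<in> A} | i A. True}"
  proof -
    have "(\<Pi>\<^sub>E i\<in>(UNIV :: int set). (UNIV :: bool set)) = UNIV" by auto
    moreover have "A \<in> sets borel" for A :: "bool set" by (simp add: sets_borel_eq_count_space)
    ultimately show ?thesis
      using sets_PiM_single[of "UNIV :: int set" "\<lambda>_. borel :: bool measure"]
      by (simp add: sets_PiM_equal_borel)
  qed
  interpret sigma_algebra UNIV "sigma_sets UNIV ?E"
    by (rule sigma_algebra_sigma_sets) simp
  have single: "{f. f i} \<in> sigma_sets UNIV ?E" for i :: int
    by (intro sigma_sets.Basic image_eqI[of _ _ "{i}"]) auto
  show "sets (borel :: biseq measure) \<subseteq> sigma_sets UNIV ?E"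
    unfolding borel
  proof (rule sigma_sets_mono, clarify)
    fix i :: int and A :: "bool set"
    have "{f. f i \<in> A} = (if True \<in> A then {f. f i} else {}) \<union> (if False \<in> A then UNIV - {f. f i} else {})"
      by (auto split: if_splits) (metis (full_types))+
    then show "{f. f i \<in> A} \<in> sigma_sets UNIV ?E"
      using single[of i] by (auto intro: compl_sets)
  qed
  have "{x :: biseq. \<forall>i\<in>I. x i} \<in> sets borel" for I
  proof -
    have "{x :: biseq. \<forall>i\<in>I. x i} = (\<Inter>i\<in>I. {x. x i = True})" by auto
    then have "closed {x :: biseq. \<forall>i\<in>I. x i}"
      by (simp only:) (intro closed_INT ballI closed_coordinate)
    then show ?thesis by (rule borel_closed)
  qed
  then show "sigma_sets UNIV ?E \<subseteq> sets (borel :: biseq measure)"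
    by (intro sets.sigma_sets_subset[of _ borel, unfolded space_borel]) auto
qed

lemma topspace_residue_topology:
  "B \<subseteq> {1..} \<Longrightarrow> topspace (residue_topology B) = (\<Pi>\<^sub>E b\<in>B. {0..<int b})"
  unfolding residue_topology_def topspace_product_topology topspace_discrete_topology
  by (intro PiE_cong) (auto simp: carrier_integer_mod_group)


section \<open>Haar measure on the closure of the integers\<close>

lemma openin_residue_box:
  assumes B: "B \<subseteq> {1..}" and K: "finite K" "K \<subseteq> B"
  shows "openin (residue_topology B) {h \<in> (\<Pi>\<^sub>E b\<in>B. {0..<int b}). \<forall>b\<in>K. h b = c b}"
  unfolding residue_topology_def openin_product_topology_alt
proof
  let ?X = "\<lambda>b. discrete_topology (carrier (integer_mod_group b))"
  fix x assume x: "x \<in> {h \<in> (\<Pi>\<^sub>E b\<in>B. {0..<int b}). \<forall>b\<in>K. h b = c b}"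
  define U where "U b = (if b \<in> K then {c b} else {0..<int b})" for b
  have car: "carrier (integer_mod_group b) = {0..<int b}" if "b \<in> B" for b
    using that B by (auto simp: carrier_integer_mod_group)
  have "{b \<in> B. U b \<noteq> topspace (?X b)} \<subseteq> K" by (auto simp: U_def car)
  then have "finite {b \<in> B. U b \<noteq> topspace (?X b)}" using K(1) finite_subset by blast
  moreover have "\<forall>b\<in>B. openin (?X b) (U b)"
    using x K(2) by (auto simp: U_def car PiE_iff subset_iff)
  moreover have "x \<in> Pi\<^sub>E B U" using x by (auto simp: U_def PiE_iff)
  moreover have "Pi\<^sub>E B U \<subseteq> {h \<in> (\<Pi>\<^sub>E b\<in>B. {0..<int b}). \<forall>b\<in>K. h b = c b}"
  proof
    fix h assume h: "h \<in> Pi\<^sub>E B U"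
    have "h b \<in> {0..<int b}" if "b \<in> B" for b
      using h x that by (cases "b \<in> K") (auto simp: U_def PiE_iff split: if_splits)
    moreover have "h b = c b" if "b \<in> K" for b
      using h that K(2) by (auto simp: U_def PiE_iff split: if_splits)
    ultimately show "h \<in> {h \<in> (\<Pi>\<^sub>E b\<in>B. {0..<int b}). \<forall>b\<in>K. h b = c b}"
      using h by (auto simp: PiE_iff)
  qed
  ultimately show "\<exists>U. finite {b \<in> B. U b \<noteq> topspace (?X b)} \<and> (\<forall>b\<in>B. openin (?X b) (U b))
      \<and> x \<in> Pi\<^sub>E B U \<and> Pi\<^sub>E B U \<subseteq> {h \<in> (\<Pi>\<^sub>E b\<in>B. {0..<int b}). \<forall>b\<in>K. h b = c b}"
    by blast
qed

lemma open_contains_residue_box: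
  assumes B: "B \<subseteq> {1..}" and U: "openin (residue_topology B) U" "g \<in> U"
  obtains K where "finite K" "K \<subseteq> B" "{h \<in> (\<Pi>\<^sub>E b\<in>B. {0..<int b}). \<forall>b\<in>K. h b = g b} \<subseteq> U"
proof -
  let ?X = "\<lambda>b. discrete_topology (carrier (integer_mod_group b))"
  obtain V where V: "finite {b \<in> B. V b \<noteq> topspace (?X b)}" "g \<in> Pi\<^sub>E B V" "Pi\<^sub>E B V \<subseteq> U"
    using U unfolding residue_topology_def openin_product_topology_alt by meson
  have car: "carrier (integer_mod_group b) = {0..<int b}" if "b \<in> B" for b
    using that B by (auto simp: carrier_integer_mod_group)
  let ?K = "{b \<in> B. V b \<noteq> topspace (?X b)}"
  have "{h \<in> (\<Pi>\<^sub>E b\<in>B. {0..<int b}). \<forall>b\<in>?K. h b = g b} \<subseteq> Pi\<^sub>E B V"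
  proof
    fix h assume h: "h \<in> {h \<in> (\<Pi>\<^sub>E b\<in>B. {0..<int b}). \<forall>b\<in>?K. h b = g b}"
    have "h b \<in> V b" if "b \<in> B" for b
    proof (cases "b \<in> ?K")
      case True
      then show ?thesis using h V(2) that by (auto simp: PiE_iff)
    next
      case False
      then have "V b = {0..<int b}" using that car by auto
      then show ?thesis using h that by (auto simp: PiE_iff)
    qed
    then show "h \<in> Pi\<^sub>E B V" using h by (auto simp: PiE_iff)
  qed
  then show thesis using that[of ?K] V(1,3) by auto
qed

text \<open>Basic open sets restrict finitely many coordinates, so being a limit of integers means being congruent to
an integer for any finite set of moduli.\<close>

lemma residue_closure_iff:
  assumes B: "B \<subseteq> {1..}"
  shows "g \<in> residue_closure B \<longleftrightarrow> g \<in> (\<Pi>\<^sub>E b\<in>B. {0..<int b}) \<and>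
    (\<forall>K. finite K \<longrightarrow> K \<subseteq> B \<longrightarrow> (\<exists>n. \<forall>b\<in>K. g b = n mod int b))"
proof
  assume g: "g \<in> residue_closure B"
  then have top: "g \<in> (\<Pi>\<^sub>E b\<in>B. {0..<int b})"
    by (auto simp: residue_closure_def in_closure_of topspace_residue_topology[OF B])
  have "\<exists>n. \<forall>b\<in>K. g b = n mod int b" if K: "finite K" "K \<subseteq> B" for K
  proof -
    let ?U = "{h \<in> (\<Pi>\<^sub>E b\<in>B. {0..<int b}). \<forall>b\<in>K. h b = g b}"
    have all: "\<forall>U. g \<in> U \<and> openin (residue_topology B) U \<longrightarrow>
        (\<exists>y. y \<in> range (\<lambda>n::int. \<lambda>b\<in>B. n mod int b) \<and> y \<in> U)"
      using g unfolding residue_closure_def in_closure_of by (rule conjunct2)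
    have "g \<in> ?U \<and> openin (residue_topology B) ?U"
      using openin_residue_box[OF B K, of g] top by simp
    then have "\<exists>y. y \<in> range (\<lambda>n::int. \<lambda>b\<in>B. n mod int b) \<and> y \<in> ?U"
      by (rule all[THEN spec, THEN mp])
    then obtain n where "(\<lambda>b\<in>B. n mod int b) \<in> ?U" by blast
    then have "\<forall>b\<in>K. g b = n mod int b" using K(2) by (auto simp: subset_iff)
    then show ?thesis ..
  qed
  with top show "g \<in> (\<Pi>\<^sub>E b\<in>B. {0..<int b}) \<and>
    (\<forall>K. finite K \<longrightarrow> K \<subseteq> B \<longrightarrow> (\<exists>n. \<forall>b\<in>K. g b = n mod int b))" by blast
next
  assume g: "g \<in> (\<Pi>\<^sub>E b\<in>B. {0..<int b}) \<and>
    (\<forall>K. finite K \<longrightarrow> K \<subseteq> B \<longrightarrow> (\<exists>n. \<forall>b\<in>K. g b = n mod int b))"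
  show "g \<in> residue_closure B"
    unfolding residue_closure_def in_closure_of topspace_residue_topology[OF B]
  proof (intro conjI allI impI)
    fix U assume U: "g \<in> U \<and> openin (residue_topology B) U"
    obtain K where K: "finite K" "K \<subseteq> B"
      "{h \<in> (\<Pi>\<^sub>E b\<in>B. {0..<int b}). \<forall>b\<in>K. h b = g b} \<subseteq> U"
      by (rule open_contains_residue_box[OF B conjunct2[OF U] conjunct1[OF U]])
    obtain n where n: "\<forall>b\<in>K. g b = n mod int b" using g K(1,2) by blast
    have "(\<lambda>b\<in>B. n mod int b) \<in> {h \<in> (\<Pi>\<^sub>E b\<in>B. {0..<int b}). \<forall>b\<in>K. h b = g b}"
      using n K(2) B by (auto simp: subset_iff)
    then show "\<exists>y. y \<in> range (\<lambda>n. \<lambda>b\<in>B. n mod int b) \<and> y \<in> U" using K(3) by blast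
  qed (use g in blast)
qed

definition cylinder :: "nat set \<Rightarrow> nat set \<Rightarrow> int \<Rightarrow> (nat \<Rightarrow> int) set" where
  "cylinder B K n = {g \<in> residue_closure B. \<forall>b\<in>K. g b = n mod int b}"

text \<open>The empty set is added to make the family closed under intersections.\<close>

definition cylinders :: "nat set \<Rightarrow> (nat \<Rightarrow> int) set set" where
  "cylinders B = insert {} ((\<lambda>(K, n). cylinder B K n) ` ({K. finite K \<and> K \<subseteq> B} \<times> UNIV))"

abbreviation residue_group_topology :: "nat set \<Rightarrow> (nat \<Rightarrow> int) topology" where
  "residue_group_topology B \<equiv> subtopology (residue_topology B) (residue_closure B)"

lemma topspace_residue_group:
  assumes "B \<subseteq> {1..}"
  shows "topspace (residue_group_topology B) = residue_closure B"
  using residue_closure_iff[OF assms]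
  by (auto simp: topspace_subtopology topspace_residue_topology[OF assms])

lemma residue_rep:
  assumes B: "B \<subseteq> {1..}" and g: "g \<in> residue_closure B" and K: "finite K" "K \<subseteq> B"
  obtains n where "\<forall>b\<in>K. g b = n mod int b"
proof -
  have "\<forall>K. finite K \<longrightarrow> K \<subseteq> B \<longrightarrow> (\<exists>n. \<forall>b\<in>K. g b = n mod int b)"
    using g unfolding residue_closure_iff[OF B] by (rule conjunct2)
  then have "\<exists>n. \<forall>b\<in>K. g b = n mod int b" using K by simp
  then show thesis using that by blast
qed

lemma cylinder_cases:
  assumes B: "B \<subseteq> {1..}" and g: "g \<in> residue_closure B" and K: "finite K" "K \<subseteq> B"
  obtains n where "\<forall>b\<in>K. g b = n mod int b"
    "cylinder B K n = {h \<in> residue_closure B. \<forall>b\<in>K. h b = g b}"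
proof -
  obtain n where n: "\<forall>b\<in>K. g b = n mod int b"
    by (rule residue_rep[OF B g K])
  then show thesis by (intro that[of n]) (auto simp: cylinder_def)
qed

lemma Int_stable_cylinders:
  assumes B: "B \<subseteq> {1..}"
  shows "Int_stable (cylinders B)"
proof (rule Int_stableI)
  fix C C' assume C: "C \<in> cylinders B" "C' \<in> cylinders B"
  show "C \<inter> C' \<in> cylinders B"
  proof (cases "C \<inter> C' = {}")
    case True
    then show ?thesis by (simp add: cylinders_def)
  next
    case False
    then obtain g where g: "g \<in> C" "g \<in> C'" by blast
    obtain K n where K: "finite K" "K \<subseteq> B" "C = cylinder B K n" using C(1) g(1) by (auto simp: cylinders_def)
    obtain K' n' where K': "finite K'" "K' \<subseteq> B" "C' = cylinder B K' n'" using C(2) g(2) by (auto simp: cylinders_def)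
    have gG: "g \<in> residue_closure B" using g K by (simp add: cylinder_def)
    have KK': "finite (K \<union> K')" "K \<union> K' \<subseteq> B" using K K' by auto
    obtain m where "\<forall>b\<in>K \<union> K'. g b = m mod int b"
      and m: "cylinder B (K \<union> K') m = {h \<in> residue_closure B. \<forall>b\<in>K \<union> K'. h b = g b}"
      by (rule cylinder_cases[OF B gG KK'])
    have "C \<inter> C' = cylinder B (K \<union> K') m"
      unfolding m using g K(3) K'(3) by (auto simp: cylinder_def)
    then show ?thesis using KK' unfolding cylinders_def by blast
  qed
qed

lemma cylinders_subset: "cylinders B \<subseteq> Pow (residue_closure B)"
  by (auto simp: cylinders_def cylinder_def)

lemma sigma_sets_cylinders:
  assumes B: "B \<subseteq> {1..}"
  shows "sigma_sets (residue_closure B) {U. openin (residue_group_topology B) U}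
       = sigma_sets (residue_closure B) (cylinders B)"
proof (rule sigma_sets_eqI)
  fix U assume "U \<in> {U. openin (residue_group_topology B) U}"
  then obtain V where V: "openin (residue_topology B) V" "U = V \<inter> residue_closure B"
    by (auto simp: openin_subtopology)
  interpret sigma_algebra "residue_closure B" "sigma_sets (residue_closure B) (cylinders B)"
    by (rule sigma_algebra_sigma_sets[OF cylinders_subset])
  have "countable {K. finite K \<and> K \<subseteq> B}"
    by (rule countable_subset[OF _ countable_Collect_finite]) auto
  then have cnt: "countable (cylinders B)" unfolding cylinders_def by auto
  have "U = \<Union>{C \<in> cylinders B. C \<subseteq> U}"
  proof (intro equalityI subsetI)
    fix g assume g: "g \<in> U"
    then obtain K where K: "finite K" "K \<subseteq> B"
      "{h \<in> (\<Pi>\<^sub>E b\<in>B. {0..<int b}). \<forall>b\<in>K. h b = g b} \<subseteq> V"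
      using open_contains_residue_box[OF B V(1)] V(2) by blast
    have gG: "g \<in> residue_closure B" using g V(2) by simp
    obtain n where "\<forall>b\<in>K. g b = n mod int b"
      and n: "cylinder B K n = {h \<in> residue_closure B. \<forall>b\<in>K. h b = g b}"
      by (rule cylinder_cases[OF B gG K(1,2)])
    have "cylinder B K n \<subseteq> U"
      unfolding n V(2) using K(3) residue_closure_iff[OF B] by blast
    moreover have "g \<in> cylinder B K n" unfolding n using gG by simp
    moreover have "cylinder B K n \<in> cylinders B" using K(1,2) unfolding cylinders_def by blast
    ultimately show "g \<in> \<Union>{C \<in> cylinders B. C \<subseteq> U}" by blast
  qed blast
  moreover have "countable {C \<in> cylinders B. C \<subseteq> U}"
    by (rule countable_subset[OF _ cnt]) auto
  then have "\<Union>{C \<in> cylinders B. C \<subseteq> U} \<in> sigma_sets (residue_closure B) (cylinders B)"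
    by (intro countable_Union) auto
  ultimately show "U \<in> sigma_sets (residue_closure B) (cylinders B)" by simp
next
  fix C assume C: "C \<in> cylinders B"
  have "openin (residue_group_topology B) C"
  proof (cases "C = {}")
    case False
    then obtain K n where K: "finite K" "K \<subseteq> B" "C = cylinder B K n" using C by (auto simp: cylinders_def)
    have "C = {h \<in> (\<Pi>\<^sub>E b\<in>B. {0..<int b}). \<forall>b\<in>K. h b = n mod int b} \<inter> residue_closure B"
      unfolding K(3) cylinder_def using residue_closure_iff[OF B] by blast
    then show ?thesis
      using openin_residue_box[OF B K(1,2), of "\<lambda>b. n mod int b"] by (auto simp: openin_subtopology)
  qed simp
  then show "C \<in> sigma_sets (residue_closure B) {U. openin (residue_group_topology B) U}" by auto
qed

text \<open>The cylinders over a fixed finite set \<open>K\<close> of moduli form a finite partition of the group, so having equal measure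
they have a prescribed measure; and the cylinders generate the Borel sets.\<close>

lemma cylinder_uniform_unique:
  assumes B: "B \<subseteq> {1..}"
    and P: "prob_space P" "sets P = sigma_sets (residue_closure B) (cylinders B)"
      "\<And>K n. finite K \<Longrightarrow> K \<subseteq> B \<Longrightarrow> measure P (cylinder B K n) = measure P (cylinder B K 0)"
    and Q: "prob_space Q" "sets Q = sigma_sets (residue_closure B) (cylinders B)"
      "\<And>K n. finite K \<Longrightarrow> K \<subseteq> B \<Longrightarrow> measure Q (cylinder B K n) = measure Q (cylinder B K 0)"
  shows "P = Q"
proof -
  let ?G = "residue_closure B"
  have cylinder_value: "measure R (cylinder B K n) = 1 / card (range (cylinder B K))"
    if R: "prob_space R" "sets R = sigma_sets ?G (cylinders B)"
      "\<And>K n. finite K \<Longrightarrow> K \<subseteq> B \<Longrightarrow> measure R (cylinder B K n) = measure R (cylinder B K 0)"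
      and K: "finite K" "K \<subseteq> B" for R K n
  proof -
    interpret R: prob_space R by (rule R)
    have space: "space R = ?G"
      using R(2) cylinders_subset by (metis sets_eq_imp_space_eq sets_measure_of space_measure_of)
    have mem: "cylinder B K n \<in> sets R" for n
      unfolding R(2) using K by (auto simp: cylinders_def)
    obtain q where q: "q > 0" "\<And>b. b \<in> K \<Longrightarrow> b dvd q"
      using common_period[OF K(1), of 1] K(2) B by auto
    have "cylinder B K n \<in> cylinder B K ` {0..<int q}" for n
    proof (rule image_eqI)
      show "cylinder B K n = cylinder B K (n mod int q)"
        using q(2) by (auto simp: cylinder_def mod_mod_cancel)
    qed (use q(1) in simp)
    then have "range (cylinder B K) \<subseteq> cylinder B K ` {0..<int q}" by blast
    then have fin: "finite (range (cylinder B K))" by (rule finite_surj[rotated]) simp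
    have disj: "disjoint (range (cylinder B K))"
      by (auto simp: disjoint_def cylinder_def)
    have "\<Union>(range (cylinder B K)) = ?G"
    proof (intro equalityI subsetI)
      fix g assume g: "g \<in> ?G"
      obtain n where "\<forall>b\<in>K. g b = n mod int b"
        and "cylinder B K n = {h \<in> ?G. \<forall>b\<in>K. h b = g b}"
        by (rule cylinder_cases[OF B g K])
      then have "g \<in> cylinder B K n" using g by simp
      then show "g \<in> \<Union>(range (cylinder B K))" by blast
    qed (auto simp: cylinder_def)
    then have "1 = measure R (\<Union>(range (cylinder B K)))"
      using R.prob_space by (simp add: space)
    also have "\<dots> = (\<Sum>C\<in>range (cylinder B K). measure R C)"
    proof -
      have "disjoint_family_on id (range (cylinder B K))"
        using disj by (auto simp: disjoint_family_on_def disjoint_def)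
      then show ?thesis
        using R.finite_measure_finite_Union[OF fin, of id] mem by (auto simp: image_subset_iff)
    qed
    also have "\<dots> = (\<Sum>C\<in>range (cylinder B K). measure R (cylinder B K n))"
    proof (rule sum.cong)
      fix C assume "C \<in> range (cylinder B K)"
      then obtain m where "C = cylinder B K m" by blast
      then show "measure R C = measure R (cylinder B K n)"
        using R(3)[OF K, of m] R(3)[OF K, of n] by simp
    qed simp
    also have "\<dots> = card (range (cylinder B K)) * measure R (cylinder B K n)" by simp
    finally show ?thesis by (metis nonzero_mult_div_cancel_left div_by_0 mult_eq_0_iff zero_neq_one)
  qed
  interpret P: prob_space P by (rule P)
  interpret Q: prob_space Q by (rule Q)
  show ?thesis
  proof (rule measure_eqI_generator_eq[OF Int_stable_cylinders[OF B] cylinders_subset _ P(2) Q(2)])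
    fix C assume "C \<in> cylinders B"
    then show "emeasure P C = emeasure Q C"
      using cylinder_value[OF P] cylinder_value[OF Q]
      by (auto simp: cylinders_def P.emeasure_eq_measure Q.emeasure_eq_measure)
  next
    show "range (\<lambda>_::nat. cylinder B {} 0) \<subseteq> cylinders B" by (auto simp: cylinders_def)
    show "(\<Union>i::nat. cylinder B {} 0) = ?G" by (auto simp: cylinder_def)
  qed simp
qed

lemma mult_residue_product:
  "g \<otimes>\<^bsub>residue_product B\<^esub> h = (\<lambda>b\<in>B. (g b + h b) mod int b)"
  by (simp add: residue_product_def product_group_def)

lemma residue_translate_closed:
  assumes B: "B \<subseteq> {1..}" and g: "g \<in> residue_closure B" and h: "h \<in> residue_closure B"
  shows "g \<otimes>\<^bsub>residue_product B\<^esub> h \<in> residue_closure B"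
  unfolding residue_closure_iff[OF B] mult_residue_product
proof (intro conjI allI impI)
  show "(\<lambda>b\<in>B. (g b + h b) mod int b) \<in> (\<Pi>\<^sub>E b\<in>B. {0..<int b})" using B by auto
  fix K assume K: "finite K" "K \<subseteq> B"
  obtain m where m: "\<forall>b\<in>K. g b = m mod int b" by (rule residue_rep[OF B g K])
  obtain n where n: "\<forall>b\<in>K. h b = n mod int b" by (rule residue_rep[OF B h K])
  have "\<forall>b\<in>K. (\<lambda>b\<in>B. (g b + h b) mod int b) b = (m + n) mod int b"
    using K(2) by (auto simp: m n mod_add_eq subset_iff)
  then show "\<exists>n. \<forall>b\<in>K. (\<lambda>b\<in>B. (g b + h b) mod int b) b = n mod int b" ..
qed

lemma residue_translate_vimage:
  assumes B: "B \<subseteq> {1..}" and g: "g \<in> residue_closure B" and K: "finite K" "K \<subseteq> B"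
    and m: "\<forall>b\<in>K. g b = m mod int b"
  shows "(\<lambda>h. g \<otimes>\<^bsub>residue_product B\<^esub> h) -` cylinder B K n \<inter> residue_closure B = cylinder B K (n - m)"
proof -
  have "(g \<otimes>\<^bsub>residue_product B\<^esub> h) b = n mod int b \<longleftrightarrow> h b = (n - m) mod int b"
    if h: "h \<in> residue_closure B" and b: "b \<in> K" for h b
  proof -
    have "h b \<in> {0..<int b}"
      using h b K(2) unfolding residue_closure_iff[OF B] by (auto simp: PiE_iff)
    then have hb: "h b mod int b = h b" by simp
    have "(g \<otimes>\<^bsub>residue_product B\<^esub> h) b = (h b + m) mod int b"
      using b K(2) by (auto simp: mult_residue_product m mod_add_right_eq add.commute)
    then show ?thesis using mod_diff_shift_iff[of "h b" m "int b" n] hb by simp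
  qed
  then show ?thesis
    using residue_translate_closed[OF B g] by (auto simp: cylinder_def)
qed

lemma residue_translate_measurable:
  assumes B: "B \<subseteq> {1..}" and g: "g \<in> residue_closure B"
    and P: "space P = residue_closure B" "sets P = sigma_sets (residue_closure B) (cylinders B)"
  shows "(\<lambda>h. g \<otimes>\<^bsub>residue_product B\<^esub> h) \<in> measurable P P"
proof (rule measurable_sigma_sets[OF P(2) cylinders_subset])
  show "(\<lambda>h. g \<otimes>\<^bsub>residue_product B\<^esub> h) \<in> space P \<rightarrow> residue_closure B"
    using residue_translate_closed[OF B g] P(1) by auto
  fix C assume C: "C \<in> cylinders B"
  show "(\<lambda>h. g \<otimes>\<^bsub>residue_product B\<^esub> h) -` C \<inter> space P \<in> sets P"
  proof (cases "C = {}")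
    case False
    then obtain K n where K: "finite K" "K \<subseteq> B" "C = cylinder B K n" using C by (auto simp: cylinders_def)
    obtain m where m: "\<forall>b\<in>K. g b = m mod int b" by (rule residue_rep[OF B g K(1,2)])
    have "(\<lambda>h. g \<otimes>\<^bsub>residue_product B\<^esub> h) -` cylinder B K n \<inter> residue_closure B = cylinder B K (n - m)"
      by (rule residue_translate_vimage[OF B g K(1,2)]) (rule m)
    moreover have "cylinder B K (n - m) \<in> sets P"
      unfolding P(2) using K(1,2) by (auto simp: cylinders_def)
    ultimately show ?thesis unfolding K(3) P(1) by simp
  qed simp
qed

definition profinite_haar :: "nat set \<Rightarrow> (nat \<Rightarrow> int) measure" where
  "profinite_haar B = distr profinite (sigma (residue_closure B) (cylinders B)) (\<lambda>\<omega>. \<lambda>b\<in>B. residue b \<omega>)"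

lemma residue_vector_in_closure:
  assumes B: "B \<subseteq> {1..}"
  shows "(\<lambda>b\<in>B. residue b \<omega>) \<in> residue_closure B"
  unfolding residue_closure_iff[OF B]
proof (intro conjI allI impI)
  show "(\<lambda>b\<in>B. residue b \<omega>) \<in> (\<Pi>\<^sub>E b\<in>B. {0..<int b})"
    using residue_bounds B by (auto simp: Suc_le_eq subset_iff)
  fix K assume K: "finite K" "K \<subseteq> B"
  obtain q where q: "q > 0" "\<And>b. b \<in> K \<Longrightarrow> b dvd q"
    using common_period[OF K(1), of 1] K(2) B by auto
  have "\<forall>b\<in>K. (\<lambda>b\<in>B. residue b \<omega>) b = residue q \<omega> mod int b"
    using residue_mod[OF q(2) q(1)] K(2) by auto
  then show "\<exists>n. \<forall>b\<in>K. (\<lambda>b\<in>B. residue b \<omega>) b = n mod int b" ..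
qed

lemma residue_vector_measurable:
  assumes B: "B \<subseteq> {1..}"
  shows "(\<lambda>\<omega>. \<lambda>b\<in>B. residue b \<omega>) \<in> measurable profinite (sigma (residue_closure B) (cylinders B))"
proof (rule measurable_measure_of[OF cylinders_subset])
  show "(\<lambda>\<omega>. \<lambda>b\<in>B. residue b \<omega>) \<in> space profinite \<rightarrow> residue_closure B"
    using residue_vector_in_closure[OF B] by auto
  fix C assume "C \<in> cylinders B"
  then consider "C = {}" | K n where "finite K" "K \<subseteq> B" "C = cylinder B K n"
    by (auto simp: cylinders_def)
  then show "(\<lambda>\<omega>. \<lambda>b\<in>B. residue b \<omega>) -` C \<inter> space profinite \<in> sets profinite"
  proof cases
    case 2
    have "countable K" by simp
    then have "Measurable.pred profinite (\<lambda>\<omega>. \<forall>b\<in>K. residue b \<omega> = n mod int b)" by measurable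
    moreover have "(\<lambda>\<omega>. \<lambda>b\<in>B. residue b \<omega>) -` C = {\<omega>. \<forall>b\<in>K. residue b \<omega> = n mod int b}"
      unfolding 2(3) cylinder_def using residue_vector_in_closure[OF B] 2(2) by auto
    ultimately show ?thesis by (simp add: pred_def)
  qed simp
qed

lemma profinite_haar_space:
  "space (profinite_haar B) = residue_closure B"
  "sets (profinite_haar B) = sigma_sets (residue_closure B) (cylinders B)"
  using cylinders_subset by (simp_all add: profinite_haar_def)

lemma prob_space_profinite_haar: "B \<subseteq> {1..} \<Longrightarrow> prob_space (profinite_haar B)"
  unfolding profinite_haar_def by (intro profinite.prob_space_distr residue_vector_measurable)

lemma profinite_haar_cylinder:
  assumes B: "B \<subseteq> {1..}" and K: "finite K" "K \<subseteq> B"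
  shows "measure (profinite_haar B) (cylinder B K n) = measure (profinite_haar B) (cylinder B K 0)"
proof -
  obtain q where q: "q > 0" "\<And>b. b \<in> K \<Longrightarrow> b dvd q"
    using common_period[OF K(1), of 1] K(2) B by auto
  define S where "S = {x. \<forall>b\<in>K. x mod int b = 0}"
  have per: "periodic q S"
    unfolding periodic_def S_def using q(2) by (auto simp: dvd_add_left_iff simp flip: dvd_eq_mod_eq_0)
  have "measure (profinite_haar B) (cylinder B K n) = profinite.prob {\<omega>. residue q \<omega> + (- n) \<in> S}" for n
  proof -
    have "cylinder B K n \<in> sets (sigma (residue_closure B) (cylinders B))"
      using K cylinders_subset by (auto simp: cylinders_def)
    then have "measure (profinite_haar B) (cylinder B K n)
        = profinite.prob ((\<lambda>\<omega>. \<lambda>b\<in>B. residue b \<omega>) -` cylinder B K n \<inter> space profinite)"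
      unfolding profinite_haar_def by (intro measure_distr residue_vector_measurable[OF B])
    also have "(\<lambda>\<omega>. \<lambda>b\<in>B. residue b \<omega>) -` cylinder B K n \<inter> space profinite = {\<omega>. residue q \<omega> + (- n) \<in> S}"
    proof -
      have "residue b \<omega> = n mod int b \<longleftrightarrow> (residue q \<omega> + (- n)) mod int b = 0" if "b \<in> K" for b \<omega>
        using residue_mod[OF q(2)[OF that] q(1), of \<omega>] mod_diff_shift_iff[of "residue q \<omega>" "- n" "int b" 0] by simp
      then show ?thesis
        unfolding cylinder_def S_def using residue_vector_in_closure[OF B] K(2) by auto
    qed
    finally show ?thesis .
  qed
  then show ?thesis using prob_residue_shift[OF per q(1)] by metis
qed

text \<open>A translate of the measure again gives equal measure to all cylinders over the same moduli.\<close>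

lemma profinite_haar_invariant:
  assumes B: "B \<subseteq> {1..}" and g: "g \<in> residue_closure B"
  shows "distr (profinite_haar B) (profinite_haar B) (\<lambda>h. g \<otimes>\<^bsub>residue_product B\<^esub> h) = profinite_haar B"
proof -
  let ?H = "profinite_haar B" and ?t = "\<lambda>h. g \<otimes>\<^bsub>residue_product B\<^esub> h"
  interpret H: prob_space ?H by (rule prob_space_profinite_haar[OF B])
  have meas: "?t \<in> measurable ?H ?H"
    by (rule residue_translate_measurable[OF B g profinite_haar_space])
  show ?thesis
  proof (rule cylinder_uniform_unique[OF B _ _ _ prob_space_profinite_haar[OF B]
        profinite_haar_space(2) profinite_haar_cylinder[OF B]])
    show "prob_space (distr ?H ?H ?t)" by (rule H.prob_space_distr[OF meas])
    show "sets (distr ?H ?H ?t) = sigma_sets (residue_closure B) (cylinders B)"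
      by (simp add: profinite_haar_space)
    fix K n assume K: "finite K" "K \<subseteq> B"
    obtain m where m: "\<forall>b\<in>K. g b = m mod int b" by (rule residue_rep[OF B g K])
    have "measure (distr ?H ?H ?t) (cylinder B K n) = measure ?H (cylinder B K (n - m))" for n
      using K meas residue_translate_vimage[OF B g K m, of n]
      by (subst measure_distr) (auto simp: profinite_haar_space cylinders_def)
    then show "measure (distr ?H ?H ?t) (cylinder B K n) = measure (distr ?H ?H ?t) (cylinder B K 0)"
      using profinite_haar_cylinder[OF B K, of "n - m"] profinite_haar_cylinder[OF B K, of "0 - m"] by simp
  qed
qed

text \<open>Invariance under the images of the integers alone makes all cylinders over the same moduli equally likely, so
\<open>cylinder_uniform_unique\<close> leaves only one candidate.\<close>

lemma haar_probability_residues: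
  assumes B: "B \<subseteq> {1..}"
  shows "haar_probability (residue_product B) (residue_group_topology B) = profinite_haar B"
  unfolding haar_probability_def topspace_residue_group[OF B] sigma_sets_cylinders[OF B]
proof (rule the_equality)
  show "prob_space (profinite_haar B) \<and> space (profinite_haar B) = residue_closure B \<and>
      sets (profinite_haar B) = sigma_sets (residue_closure B) (cylinders B) \<and>
      (\<forall>g\<in>residue_closure B. distr (profinite_haar B) (profinite_haar B)
        (\<lambda>h. g \<otimes>\<^bsub>residue_product B\<^esub> h) = profinite_haar B)"
    using prob_space_profinite_haar[OF B] profinite_haar_space profinite_haar_invariant[OF B] by blast
  fix P :: "(nat \<Rightarrow> int) measure"
  assume P: "prob_space P \<and> space P = residue_closure B \<and>
      sets P = sigma_sets (residue_closure B) (cylinders B) \<and>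
      (\<forall>g\<in>residue_closure B. distr P P (\<lambda>h. g \<otimes>\<^bsub>residue_product B\<^esub> h) = P)"
  show "P = profinite_haar B"
  proof (rule cylinder_uniform_unique[OF B _ _ _ prob_space_profinite_haar[OF B]
        profinite_haar_space(2) profinite_haar_cylinder[OF B]])
    fix K n assume K: "finite K" "K \<subseteq> B"
    define g where "g = (\<lambda>b\<in>B. n mod int b)"
    have g: "g \<in> residue_closure B"
      unfolding residue_closure_iff[OF B] g_def using B by auto
    have m: "\<forall>b\<in>K. g b = n mod int b" using K(2) by (auto simp: g_def)
    have "measure P (cylinder B K n) = measure (distr P P (\<lambda>h. g \<otimes>\<^bsub>residue_product B\<^esub> h)) (cylinder B K n)"
      using P g by simp
    also have "\<dots> = measure P (cylinder B K (n - n))"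
      using K P residue_translate_measurable[OF B g, of P] residue_translate_vimage[OF B g K m, of n]
      by (subst measure_distr) (auto simp: cylinders_def)
    finally show "measure P (cylinder B K n) = measure P (cylinder B K 0)" by simp
  qed (use P in blast)+
qed

lemma mirsky_map_measurable:
  assumes B: "B \<subseteq> {1..}"
  shows "mirsky_map B \<in> measurable (sigma (residue_closure B) (cylinders B)) borel"
proof (rule borel_measurable_biseq)
  let ?M = "sigma (residue_closure B) (cylinders B)"
  fix n
  have coord: "{g \<in> residue_closure B. \<not> [n \<noteq> - g b] (mod int b)} \<in> sets ?M" if b: "b \<in> B" for b
  proof -
    have "{g \<in> residue_closure B. \<not> [n \<noteq> - g b] (mod int b)} = cylinder B {b} (- n)"
    proof -
      have "\<not> [n \<noteq> - g b] (mod int b) \<longleftrightarrow> g b = (- n) mod int b" if "g \<in> residue_closure B" for g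
      proof -
        have "g b \<in> {0..<int b}"
          using that b unfolding residue_closure_iff[OF B] by (auto simp: PiE_iff)
        then have "g b mod int b = g b" by simp
        moreover have "[n = - g b] (mod int b) \<longleftrightarrow> [g b = - n] (mod int b)"
          unfolding cong_iff_dvd_diff by (simp add: algebra_simps)
        ultimately show ?thesis by (simp add: cong_def)
      qed
      then show ?thesis by (auto simp: cylinder_def)
    qed
    then show ?thesis using b cylinders_subset by (auto simp: cylinders_def)
  qed
  have "{g \<in> space ?M. mirsky_map B g n} = space ?M - (\<Union>b\<in>B. {g \<in> residue_closure B. \<not> [n \<noteq> - g b] (mod int b)})"
    using cylinders_subset by (auto simp: mirsky_map_def)
  also have "\<dots> \<in> sets ?M"
    using coord by (intro sets.Diff sets.top sets.countable_UN'') auto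
  finally show "Measurable.pred ?M (\<lambda>g. mirsky_map B g n)" by (simp add: pred_def)
qed

lemma mirsky_measure_eq:
  assumes B: "B \<subseteq> {1..}"
  shows "mirsky_measure B = distr profinite borel (sieve B)"
proof -
  have "mirsky_map B (\<lambda>b\<in>B. residue b \<omega>) = sieve B \<omega>" for \<omega>
    unfolding mirsky_map_def sieve_def
    by (intro ext ball_cong refl) (simp add: cong_iff_dvd_diff add.commute)
  then show ?thesis
    unfolding mirsky_measure_def haar_probability_residues[OF B] profinite_haar_def
    by (subst distr_distr[OF mirsky_map_measurable[OF B] residue_vector_measurable[OF B]])
       (simp add: o_def)
qed

section \<open>The Mirsky measure\<close>

lemma sieve_measurable: "sieve B \<in> borel_measurable profinite"
  by (rule borel_measurable_biseq) measurable

lemma shift_measurable: "shift \<in> borel_measurable borel"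
proof (rule borel_measurable_biseq)
  fix n
  have "{x :: biseq. shift x n} \<in> sets borel"
    using borel_closed[OF closed_coordinate[of "n + 1" True]] by (simp add: shift_by_def)
  then show "Measurable.pred borel (\<lambda>x. shift x n)" by (simp add: pred_def)
qed

text \<open>The events that finitely many prescribed positions are occupied generate the Borel sets and are stable under
intersection; their probabilities are translation invariant.\<close>

lemma mirsky_measure_shift:
  assumes B: "B \<subseteq> {1..}"
  shows "distr (mirsky_measure B) borel shift = mirsky_measure B"
proof -
  let ?E = "(\<lambda>I. {x :: biseq. \<forall>i\<in>I. x i}) ` {I. finite I}"
  have meas: "(\<lambda>\<omega>. shift (sieve B \<omega>)) \<in> borel_measurable profinite"
    using measurable_compose[OF sieve_measurable shift_measurable] .
  have "distr (mirsky_measure B) borel shift = distr profinite borel (\<lambda>\<omega>. shift (sieve B \<omega>))"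
    unfolding mirsky_measure_eq[OF B]
    by (subst distr_distr[OF shift_measurable sieve_measurable]) (simp add: o_def)
  also have "\<dots> = distr profinite borel (sieve B)"
  proof (rule measure_eqI_generator_eq[where E = ?E and \<Omega> = UNIV and A = "\<lambda>_. UNIV"])
    show "Int_stable ?E"
    proof (rule Int_stableI, clarify)
      fix I J :: "int set" assume "finite I" "finite J"
      then show "{x :: biseq. \<forall>i\<in>I. x i} \<inter> {x. \<forall>i\<in>J. x i} \<in> ?E"
        by (intro image_eqI[of _ _ "I \<union> J"]) auto
    qed
    show "range (\<lambda>_::nat. UNIV) \<subseteq> ?E" by (auto intro!: image_eqI[of _ _ "{}"])
    fix X assume X: "X \<in> ?E"
    then obtain I where I: "X = {x. \<forall>i\<in>I. x i}" by blast
    have Xb: "X \<in> sets borel" unfolding sets_borel_biseq using X by blast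
    have "{\<omega>. \<forall>i\<in>I. sieve B \<omega> (i + 1)} = sieve_event 1 (0 - 1) ((\<lambda>i. i + 1) ` I) B"
      by (auto simp: sieve_event_def residue_def)
    moreover have "{\<omega>. \<forall>i\<in>I. sieve B \<omega> i} = sieve_event 1 0 I B"
      by (auto simp: sieve_event_def residue_def)
    ultimately have "profinite.prob {\<omega>. \<forall>i\<in>I. sieve B \<omega> (i + 1)} = profinite.prob {\<omega>. \<forall>i\<in>I. sieve B \<omega> i}"
      using prob_sieve_event_shift[OF B, of 1 0 1 I] by simp
    then show "emeasure (distr profinite borel (\<lambda>\<omega>. shift (sieve B \<omega>))) X
        = emeasure (distr profinite borel (sieve B)) X"
      unfolding emeasure_distr[OF meas Xb] emeasure_distr[OF sieve_measurable Xb]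
      by (simp add: I shift_by_def vimage_def profinite.emeasure_eq_measure)
  next
    show "emeasure (distr profinite borel (\<lambda>\<omega>. shift (sieve B \<omega>))) UNIV \<noteq> \<infinity>"
      using finite_measure.emeasure_finite[OF prob_space.finite_measure[OF profinite.prob_space_distr[OF meas]]]
      by simp
  qed (simp_all add: sets_borel_biseq)
  finally show ?thesis by (simp add: mirsky_measure_eq[OF B])
qed

lemma mirsky_measure_full_iff:
  assumes B: "B \<subseteq> {1..}" and X: "closed X"
  shows "emeasure (mirsky_measure B) X = 1 \<longleftrightarrow> (AE \<omega> in profinite. sieve B \<omega> \<in> X)"
proof -
  interpret M: prob_space "mirsky_measure B"
    unfolding mirsky_measure_eq[OF B] by (rule profinite.prob_space_distr[OF sieve_measurable])
  have Xb: "X \<in> sets borel" using X by (rule borel_closed)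
  have "emeasure (mirsky_measure B) X = 1 \<longleftrightarrow> (AE x in mirsky_measure B. x \<in> X)"
    using M.emeasure_eq_1_AE[of X] M.AE_in_set_eq_1[of X] Xb
    by (simp add: mirsky_measure_eq[OF B] M.emeasure_eq_measure[unfolded mirsky_measure_eq[OF B]])
  also have "\<dots> \<longleftrightarrow> (AE \<omega> in profinite. sieve B \<omega> \<in> X)"
    unfolding mirsky_measure_eq[OF B] using AE_distr_iff[OF sieve_measurable, of "\<lambda>x. x \<in> X"] Xb by simp
  finally show ?thesis .
qed

lemma mirsky_measure_invariant:
  assumes B: "B \<subseteq> {1..}"
  shows "mirsky_measure B \<in> invariant_measures (X_eta_hereditary B)"
  unfolding invariant_measures_def
proof (intro CollectI conjI)
  show "sets (mirsky_measure B) = sets borel" by (simp add: mirsky_measure_eq[OF B])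
  show "prob_space (mirsky_measure B)"
    unfolding mirsky_measure_eq[OF B] by (rule profinite.prob_space_distr[OF sieve_measurable])
  show "distr (mirsky_measure B) borel shift = mirsky_measure B" by (rule mirsky_measure_shift[OF B])
  show "emeasure (mirsky_measure B) (X_eta_hereditary B) = 1"
    using AE_sieve_in_hull[OF B] hereditary_hull_smallest(1)
    by (subst mirsky_measure_full_iff[OF B]) (auto simp: subshift_def)
qed

lemma taut_mirsky_admissible:
  assumes "taut B" "B \<subseteq> {1..}" "B' \<subseteq> {1..}"
    and inv: "mirsky_measure B \<in> invariant_measures (X_eta_hereditary B')" and "b' \<in> B'"
  shows "\<exists>b\<in>B. b dvd b'"
proof -
  have "closed (X_eta_hereditary B')"
    using hereditary_hull_smallest(1) by (auto simp: subshift_def)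
  then have "AE \<omega> in profinite. sieve B \<omega> \<in> X_eta_hereditary B'"
    using inv mirsky_measure_full_iff[OF assms(2)] by (auto simp: invariant_measures_def)
  then have "AE \<omega> in profinite. sieve B \<omega> \<in> admissible B'"
    by eventually_elim (use X_eta_hereditary_subset_admissible[OF assms(3)] in blast)
  then show ?thesis by (rule taut_AE_sieve_admissible[OF assms(1-3) _ assms(5)])
qed

section \<open>Recovering a taut set\<close>

lemma taut_primitive:
  assumes "taut B" "b \<in> B" "c \<in> B" "b dvd c"
  shows "b = c"
proof (rule ccontr)
  assume "b \<noteq> c"
  have "int c dvd n \<Longrightarrow> int b dvd n" for n using assms(4) by (meson dvd_trans int_dvd_int_iff)
  then have "multiples (B - {c}) = multiples B"
    using \<open>b \<noteq> c\<close> assms(2,3) unfolding multiples_def by blast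
  then show False using assms(1,3) by (auto simp: taut_def)
qed

text \<open>A chain \<open>c' dvd b dvd c\<close> whose two ends lie in the same taut set collapses to \<open>c' = b = c\<close>.\<close>

lemma taut_eq_if_mutually_dividing:
  assumes "taut B" "taut B'"
    and "\<And>b'. b' \<in> B' \<Longrightarrow> \<exists>b\<in>B. b dvd b'" and "\<And>b. b \<in> B \<Longrightarrow> \<exists>b'\<in>B'. b' dvd b"
  shows "B = B'"
proof -
  have "C' \<subseteq> C" if C: "taut C'" "\<And>b'. b' \<in> C' \<Longrightarrow> \<exists>b\<in>C. b dvd b'"
    "\<And>b. b \<in> C \<Longrightarrow> \<exists>b'\<in>C'. b' dvd b" for C C'
  proof
    fix c assume c: "c \<in> C'"
    then obtain b where b: "b \<in> C" "b dvd c" using C(2) by blast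
    then obtain c' where c': "c' \<in> C'" "c' dvd b" using C(3) by blast
    have "c' = c" using taut_primitive[OF C(1) c'(1) c] c'(2) b(2) dvd_trans by blast
    then have "b = c" using b(2) c'(2) dvd_antisym by blast
    then show "c \<in> C" using b(1) by simp
  qed
  from this[OF assms(2,3,4)] this[OF assms(1,4,3)] show ?thesis by auto
qed

theorem theorem12:
  fixes B B' :: "nat set"
  assumes "B \<subseteq> {1..}" and "B' \<subseteq> {1..}"
    and "taut B" and "taut B'"
  shows "(B = B' \<longleftrightarrow> multiples B = multiples B') \<and>
         (B = B' \<longleftrightarrow> admissible B = admissible B') \<and>
         (B = B' \<longleftrightarrow> X_eta_hereditary B = X_eta_hereditary B') \<and>
         (B = B' \<longleftrightarrow> X_eta B = X_eta B') \<and>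
         (B = B' \<longleftrightarrow> mirsky_measure B = mirsky_measure B') \<and>
         (B = B' \<longleftrightarrow> invariant_measures (X_eta_hereditary B) =
                    invariant_measures (X_eta_hereditary B'))"
proof -
  have admissible: "B = B'" if "eta B \<in> admissible B'" "eta B' \<in> admissible B"
    using taut_eta_admissible[OF assms(3,1,2) that(1)] taut_eta_admissible[OF assms(4,2,1) that(2)]
    by (rule taut_eq_if_mutually_dividing[OF assms(3,4)])
  have measure: "B = B'"
    if "mirsky_measure B \<in> invariant_measures (X_eta_hereditary B')"
       "mirsky_measure B' \<in> invariant_measures (X_eta_hereditary B)"
    using taut_mirsky_admissible[OF assms(3,1,2) that(1)] taut_mirsky_admissible[OF assms(4,2,1) that(2)]
    by (rule taut_eq_if_mutually_dividing[OF assms(3,4)])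
  have eta_hull: "eta C \<in> X_eta_hereditary C" for C
    using shift_eta_in_X_eta[of 0 C] hereditary_hull_smallest(3) by (auto simp: shift_by_0)
  have in_multiples: "int c \<in> multiples C" if "c \<in> C" for c C
    unfolding multiples_def by (rule UN_I[OF that]) simp
  have b: "B = B'" if eq: "multiples B = multiples B'"
  proof (rule taut_eq_if_mutually_dividing[OF assms(3,4)])
    show "\<exists>b\<in>B. b dvd b'" if "b' \<in> B'" for b'
    proof -
      have "int b' \<in> multiples B" using in_multiples[OF that] eq by simp
      then show ?thesis by (auto simp: multiples_def)
    qed
    show "\<exists>b'\<in>B'. b' dvd b" if "b \<in> B" for b
    proof -
      have "int b \<in> multiples B'" using in_multiples[OF that] eq by simp
      then show ?thesis by (auto simp: multiples_def)
    qed
  qed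
  have c: "B = B'" if "admissible B = admissible B'"
    using that eta_admissible assms by (intro admissible) auto
  have d: "B = B'" if "X_eta_hereditary B = X_eta_hereditary B'"
    using that eta_hull X_eta_hereditary_subset_admissible assms(1,2) by (intro admissible) blast+
  have e: "B = B'" if "X_eta B = X_eta B'"
    using that by (intro d) simp
  have f: "B = B'" if "mirsky_measure B = mirsky_measure B'"
    using that mirsky_measure_invariant assms(1,2) by (intro measure) metis+
  have g: "B = B'" if "invariant_measures (X_eta_hereditary B) = invariant_measures (X_eta_hereditary B')"
    using that mirsky_measure_invariant assms(1,2) by (intro measure) auto
  from b c d e f g show ?thesis by blast
qed

end
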